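(* Let $P:\{0,1\}^3\to\{0,1\}$ be a predicate. (a) If $P$ has no affine projection to AND, then there are absolute constants $C,c$ such that for every $0<\varepsilon<1$ and every instance of CSP$(P)$ on $k$ Boolean variables, the instance has a $(1\pm\varepsilon)$-sparsifier using at most $C\frac{k}{\varepsilon^2}(\log_2(4k/\varepsilon))^{c}$ constraints. (b) If $P$ has an affine projection to AND, then there is a constant $c_0>0$ such that for every $\varepsilon\in[0,1)$ and every sufficiently large $k$ there is an instance of CSP$(P)$ on $k$ Boolean variables for which every $(1\pm\varepsilon)$-sparsifier uses at least $c_0k^2$ constraints.
   Context: A predicate $P:\{0,1\}^r\to\{0,1\}$ has an affine projection to AND if there exists $\pi:[r]\to\{0,1,x,\neg x,y,\neg y\}$ such that $\mathrm{AND}(x,y)=P(\pi(1),\dots,\pi(r))$ for all $x,y\in\{0,1\}$. An instance of CSP$(P)$ on Boolean variables $x_1,\dots,x_k$ is a list of constraints $C_j = P(x_{j,1},\dots,x_{j,r})$, $j\in[m]$, each applying $P$ to an $r$-tuple of the variables; its value on an assignment $x\in\{0,1\}^k$ is $\sum_j C_j(x)$. A $(1\pm\varepsilon)$-sparsifier is a subset $T\subseteq[m]$ with nonnegative weights $(w_j)_{j\in T}$ such that for every $x\in\{0,1\}^k$, $(1-\varepsilon)\sum_{j=1}^mC_j(x)\le\sum_{j\in T}w_jC_j(x)\le(1+\varepsilon)\sum_{j=1}^mC_j(x)$. *)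

theory Defs
  imports Complex_Main
begin

datatype lit = Zero | One | X | NotX | Y | NotY

fun lit_val :: "lit \<Rightarrow> bool \<Rightarrow> bool \<Rightarrow> bool" where
  "lit_val Zero x y = False"
| "lit_val One x y = True"
| "lit_val X x y = x"
| "lit_val NotX x y = (\<not> x)"
| "lit_val Y x y = y"
| "lit_val NotY x y = (\<not> y)"

definition has_affine_projection_to_AND :: "(bool \<Rightarrow> bool \<Rightarrow> bool \<Rightarrow> bool) \<Rightarrow> bool" where
  "has_affine_projection_to_AND P \<longleftrightarrow>
     (\<exists>\<pi> :: nat \<Rightarrow> lit. \<forall>x y.
        (x \<and> y) = P (lit_val (\<pi> 1) x y) (lit_val (\<pi> 2) x y) (lit_val (\<pi> 3) x y))"

text \<open>An instance of CSP(P) on variables x_0..x_{k-1}: a list of constraints, each a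
  triple of variable indices (repetitions allowed).  Assignments are functions nat => bool
  (only indices below k matter).\<close>

definition is_instance :: "nat \<Rightarrow> (nat \<times> nat \<times> nat) list \<Rightarrow> bool" where
  "is_instance k cs \<longleftrightarrow> (\<forall>(a, b, c) \<in> set cs. a < k \<and> b < k \<and> c < k)"

definition constr_val :: "(bool \<Rightarrow> bool \<Rightarrow> bool \<Rightarrow> bool) \<Rightarrow> (nat \<times> nat \<times> nat) \<Rightarrow> (nat \<Rightarrow> bool) \<Rightarrow> real" where
  "constr_val P t x = (case t of (a, b, c) \<Rightarrow> if P (x a) (x b) (x c) then 1 else 0)"

definition is_sparsifier ::
  "(bool \<Rightarrow> bool \<Rightarrow> bool \<Rightarrow> bool) \<Rightarrow> nat \<Rightarrow> (nat \<times> nat \<times> nat) list \<Rightarrow> real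
     \<Rightarrow> nat set \<Rightarrow> (nat \<Rightarrow> real) \<Rightarrow> bool" where
  "is_sparsifier P k cs \<epsilon> T w \<longleftrightarrow>
     T \<subseteq> {..<length cs} \<and> (\<forall>j\<in>T. 0 \<le> w j) \<and>
     (\<forall>x :: nat \<Rightarrow> bool. (\<forall>i. k \<le> i \<longrightarrow> \<not> x i) \<longrightarrow>
        (1 - \<epsilon>) * (\<Sum>j<length cs. constr_val P (cs ! j) x) \<le> (\<Sum>j\<in>T. w j * constr_val P (cs ! j) x) \<and>
        (\<Sum>j\<in>T. w j * constr_val P (cs ! j) x) \<le> (1 + \<epsilon>) * (\<Sum>j<length cs. constr_val P (cs ! j) x))"

end

theory Submission
  imports Defs "HOL-Library.Numeral_Type" "HOL-Library.FuncSet"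
begin

text \<open>
  Part (a). A ternary predicate without an affine projection to AND is the support of an affine form
  over the integers modulo 4, so an instance is a code over that group, weighted by the
  multiplicities of the constraints, and the number of satisfied constraints is the weight of a word.
  Such a code is sparsified as in Khanna, Putterman and Sudan: after removing few coordinates every
  subcode has support at least \<open>d\<close> times its rank, so by Karger's contraction argument there are few
  words of small weight, and a random half of the remaining coordinates, counted twice, preserves all
  weights. Iterating this handles one binary digit of the multiplicities; distant digits do not
  interact, which makes the bound independent of the number of constraints.

  Part (b). A projection to AND turns a quadratic number of pairs into constraints each of which is the only
  satisfied one for some assignment, so that none of them can be dropped.
\<close>

subsection \<open>Light words of a code\<close>

text \<open>Parity of three variables is the support of an affine form only for an even modulus, and
  OR of three variables is not one modulo 2, so no prime modulus serves all predicates. Over a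
  non-field the words have no dimension, and every rank argument becomes a comparison of
  cardinalities of finite groups. The obstacle to plain random sampling is a word of small weight: a
  union bound over exponentially many words would ask every nonzero weight to be of order k /
  \<epsilon>^2. In a dense code the words of weight at most \<open>a * d\<close> number only a
  constant times (2r)^a, where r bounds the rank, so \<open>d\<close> may be logarithmic in k up to
  the error allowed per halving. Coordinates are distinct triples, at most \<open>k ^ 3\<close> of
  them, so O(log k) halvings suffice whatever the multiplicities are.\<close>

definition is_code :: "('e \<Rightarrow> 'g::ab_group_add) set \<Rightarrow> bool" where
  "is_code C \<longleftrightarrow> finite C \<and> (\<lambda>_. 0) \<in> C \<and> (\<forall>f\<in>C. \<forall>g\<in>C. (\<lambda>e. f e - g e) \<in> C)"

definition wt :: "'e set \<Rightarrow> ('e \<Rightarrow> 'g::zero) \<Rightarrow> nat" where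
  "wt A f = card {e \<in> A. f e \<noteq> 0}"

definition restr :: "'e set \<Rightarrow> ('e \<Rightarrow> 'g::zero) \<Rightarrow> 'e \<Rightarrow> 'g" where
  "restr A f = (\<lambda>e. if e \<in> A then f e else 0)"

definition shortened :: "'e set \<Rightarrow> ('e \<Rightarrow> 'g::zero) set \<Rightarrow> ('e \<Rightarrow> 'g) set" where
  "shortened A C = {f \<in> C. \<forall>e\<in>A. f e = 0}"

text \<open>\<open>log 2 (card H)\<close> plays the role of the rank, which makes sense over any finite abelian group.\<close>

definition dense :: "real \<Rightarrow> ('e \<Rightarrow> 'g::ab_group_add) set \<Rightarrow> 'e set \<Rightarrow> bool" where
  "dense d C A \<longleftrightarrow>
     (\<forall>H\<subseteq>C. is_code H \<longrightarrow> d * log 2 (card H) \<le> card {e\<in>A. \<exists>f\<in>H. f e \<noteq> 0})"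

section \<open>Restriction, shortening and rank\<close>

lemma is_codeD:
  assumes "is_code C"
  shows "finite C" "(\<lambda>_. 0) \<in> C" "\<And>f g. f \<in> C \<Longrightarrow> g \<in> C \<Longrightarrow> (\<lambda>e. f e - g e) \<in> C"
  using assms by (auto simp: is_code_def)

lemma is_code_add:
  fixes C :: "('e \<Rightarrow> 'g::ab_group_add) set"
  assumes "is_code C" "f \<in> C" "g \<in> C"
  shows "(\<lambda>e. f e + g e) \<in> C"
proof -
  have "(\<lambda>e. f e - (0 - g e)) \<in> C"
    using is_codeD(3)[OF assms(1) assms(2) is_codeD(3)[OF assms(1) is_codeD(2)[OF assms(1)] assms(3)]]
    by simp
  then show ?thesis by simp
qed

lemma card_code_pos: "is_code C \<Longrightarrow> 0 < card C"
  by (auto simp: is_code_def card_gt_0_iff)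

lemma is_code_shortened: "is_code C \<Longrightarrow> is_code (shortened A C)"
  by (auto simp: is_code_def shortened_def)

lemma is_code_restr:
  assumes "is_code C"
  shows "is_code (restr A ` C)"
  unfolding is_code_def
proof (intro conjI ballI)
  show "finite (restr A ` C)" using is_codeD(1)[OF assms] by simp
  have "(\<lambda>_. 0) = restr A (\<lambda>_. 0 :: 'b)" by (auto simp: restr_def)
  then show "(\<lambda>_. 0) \<in> restr A ` C" using is_codeD(2)[OF assms] by (rule image_eqI)
next
  fix f' g' assume "f' \<in> restr A ` C" "g' \<in> restr A ` C"
  then obtain f g where fg: "f \<in> C" "g \<in> C" "f' = restr A f" "g' = restr A g" by blast
  then have "(\<lambda>e. f' e - g' e) = restr A (\<lambda>e. f e - g e)" by (auto simp: restr_def)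
  then show "(\<lambda>e. f' e - g' e) \<in> restr A ` C" using is_codeD(3)[OF assms fg(1,2)] by (rule image_eqI)
qed

lemma restr_restr: "restr A (restr B f) = restr (A \<inter> B) f"
  by (auto simp: restr_def)

lemma wt_restr: "B \<subseteq> A \<Longrightarrow> wt B (restr A f) = wt B f"
  unfolding wt_def restr_def by (rule arg_cong[where f = card]) auto

text \<open>Half of the first isomorphism theorem for restriction to \<open>A\<close>, whose kernel
  is the shortened code: adding kernel words to one representative of each fibre gives distinct
  words of \<open>C\<close>.\<close>

lemma card_restr_mult_shortened_le:
  fixes C :: "('e \<Rightarrow> 'g::ab_group_add) set"
  assumes C: "is_code C"
  shows "card (restr A ` C) * card (shortened A C) \<le> card C"
proof -
  define rep where "rep = inv_into C (restr A)"
  have rep: "rep g \<in> C \<and> restr A (rep g) = g" if "g \<in> restr A ` C" for g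
    unfolding rep_def using that by (metis f_inv_into_f inv_into_into)
  let ?h = "\<lambda>(g, z). (\<lambda>e. rep g e + z e)"
  have "inj_on ?h (restr A ` C \<times> shortened A C)"
  proof (rule inj_onI, clarify)
    fix f z f' z'
    assume f: "f \<in> C" "f' \<in> C" and z: "z \<in> shortened A C" "z' \<in> shortened A C"
      and eq: "(\<lambda>e. rep (restr A f) e + z e) = (\<lambda>e. rep (restr A f') e + z' e)"
    have "rep (restr A f) e = rep (restr A f') e" if "e \<in> A" for e
      using fun_cong[OF eq, of e] z that by (simp add: shortened_def)
    then have "restr A (rep (restr A f)) = restr A (rep (restr A f'))"
      by (auto simp: restr_def)
    then have 1: "restr A f = restr A f'"
      using rep f by auto
    moreover have "z e = z' e" for e
      using fun_cong[OF eq, of e] 1 by simp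
    ultimately show "restr A f = restr A f' \<and> z = z'" by blast
  qed
  moreover have "?h ` (restr A ` C \<times> shortened A C) \<subseteq> C"
    using rep is_code_add[OF C] by (auto simp: shortened_def)
  ultimately have "card (restr A ` C \<times> shortened A C) \<le> card C"
    using card_inj_on_le is_codeD(1)[OF C] by blast
  then show ?thesis by (simp add: card_cartesian_product)
qed

text \<open>The charging inequality: the rank of a subcode killed by restriction is paid out of the
  rank of \<open>C\<close>.\<close>

lemma log_card_restr_shortened_le:
  assumes C: "is_code C" and D: "is_code D" and "D \<subseteq> shortened A C"
  shows "log 2 (card (restr A ` C)) + log 2 (card D) \<le> log 2 (card C)"
proof -
  have "card D \<le> card (shortened A C)"
    using assms is_codeD(1)[OF is_code_shortened[OF C]] by (intro card_mono)
  then have "card (restr A ` C) * card D \<le> card C"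
    using card_restr_mult_shortened_le[OF C, of A] by (meson le_trans mult_le_mono2)
  then have "real (card (restr A ` C)) * card D \<le> card C"
    by (metis of_nat_le_iff of_nat_mult)
  moreover have "0 < card (restr A ` C)" "0 < card D" "0 < card C"
    using card_code_pos C D is_code_restr by blast+
  ultimately have "log 2 (real (card (restr A ` C)) * card D) \<le> log 2 (card C)"
    by simp
  then show ?thesis
    using \<open>0 < card (restr A ` C)\<close> \<open>0 < card D\<close> by (simp add: log_mult)
qed

lemma denseD:
  "dense d C A \<Longrightarrow> H \<subseteq> C \<Longrightarrow> is_code H \<Longrightarrow> d * log 2 (card H) \<le> card {e\<in>A. \<exists>f\<in>H. f e \<noteq> 0}"
  by (simp add: dense_def)

lemma dense_mono: "dense d C A \<Longrightarrow> D \<subseteq> C \<Longrightarrow> dense d D A"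
  unfolding dense_def by blast

lemma card_shortened_half:
  assumes C: "is_code C" and "f \<in> C" "f e \<noteq> 0"
  shows "2 * card (shortened {e} C) \<le> card C"
proof -
  have "card {restr {e} f, \<lambda>_. 0} \<le> card (restr {e} ` C)"
    using is_codeD(1,2)[OF is_code_restr[OF C, of "{e}"]] assms by (intro card_mono) auto
  moreover have "restr {e} f \<noteq> (\<lambda>_. 0)"
    using assms by (metis restr_def singletonI)
  ultimately have "2 \<le> card (restr {e} ` C)" by simp
  then show ?thesis
    using card_restr_mult_shortened_le[OF C, of "{e}"] by (meson le_trans mult_le_mono1)
qed

text \<open>Density is applied to the words vanishing wherever \<open>f\<close> does on
  \<open>A\<close>. They include \<open>f\<close> and 0, so their rank is at least 1, and their
  joint support in \<open>A\<close> is that of \<open>f\<close>.\<close>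

lemma dense_wt_ge:
  assumes C: "is_code C" and "dense d C A" "0 \<le> d" "f \<in> C" "f \<noteq> (\<lambda>_. 0)"
  shows "d \<le> wt A f"
proof -
  let ?H = "shortened {e \<in> A. f e = 0} C"
  have H: "is_code ?H" by (rule is_code_shortened[OF C])
  have "card {f, \<lambda>_. 0} \<le> card ?H"
    using is_codeD(1,2)[OF H] assms by (intro card_mono) (auto simp: shortened_def)
  then have "1 \<le> log 2 (card ?H)"
    using assms card_code_pos[OF H] by (subst le_log_iff) auto
  then have "d * 1 \<le> d * log 2 (card ?H)"
    using assms by (intro mult_left_mono)
  also have "\<dots> \<le> card {e\<in>A. \<exists>g\<in>?H. g e \<noteq> 0}"
    using denseD[OF assms(2) _ H] by (simp add: shortened_def)
  also have "{e\<in>A. \<exists>g\<in>?H. g e \<noteq> 0} = {e\<in>A. f e \<noteq> 0}"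
    using assms by (auto simp: shortened_def)
  finally show ?thesis by (simp add: wt_def)
qed

text \<open>Karger's contraction argument: shortening the code at a random coordinate of its support
  keeps a word of weight at most \<open>a * d\<close> with probability at least \<open>1 - a / (r + 1)\<close>.\<close>

lemma card_light_words_le_choose:
  fixes C :: "('e \<Rightarrow> 'g::ab_group_add) set" and d :: real
  assumes "is_code C" "dense d C A" "finite A" "0 < d" "card C < 2 ^ (r + 1)" "a \<le> r"
  shows "card {f \<in> C. real (wt A f) \<le> a * d} \<le> 2 ^ (a + 1) * (r choose a)"
  using assms(6,1,2,5)
proof (induction r arbitrary: C rule: dec_induct)
  case base
  have "card {f \<in> C. real (wt A f) \<le> a * d} \<le> card C"
    using base is_codeD(1) by (intro card_mono) auto
  then show ?case using base by simp
next
  case (step r)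
  note C = \<open>is_code C\<close>
  have fin: "finite C" by (rule is_codeD(1)[OF C])
  define B where "B = 2 ^ (a + 1) * (r choose a)"
  show ?case
  proof (cases "card C < 2 ^ (r + 1)")
    case True
    then have "card {f \<in> C. real (wt A f) \<le> a * d} \<le> B"
      unfolding B_def using step by blast
    moreover have "r choose a \<le> Suc r choose a"
      by (cases a) auto
    ultimately show ?thesis unfolding B_def
      by (meson le_trans mult_le_mono2)
  next
    case False
    define M where "M = {f \<in> C. real (wt A f) \<le> a * d}"
    define S where "S = {e \<in> A. \<exists>f\<in>C. f e \<noteq> 0}"
    have "finite M" "finite S" using fin assms(3) by (auto simp: M_def S_def)
    have "real (2 ^ (r + 1)) \<le> real (card C)"
      using False by (metis not_less of_nat_le_iff)
    then have "real (r + 1) \<le> log 2 (card C)"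
      using le_log2_of_power[of "r + 1" "card C"] False by simp
    then have "d * (r + 1) \<le> d * log 2 (card C)"
      using assms(4) by (intro mult_left_mono) auto
    also have "\<dots> \<le> card S"
      unfolding S_def by (rule denseD[OF step.prems(2) order_refl C])
  finally have S: "d * (r + 1) \<le> card S" .
    \<comment> \<open>Double counting of the pairs of a coordinate \<open>e\<close> of the support
      and a light word with \<open>f e = 0\<close>: shortening at \<open>e\<close> halves the code,
      so the induction hypothesis bounds each \<open>e\<close>, while a light word has at least
      \<open>card S - a * d\<close> zeros in \<open>S\<close>.\<close>
    have "(\<Sum>e\<in>S. card {f \<in> M. f e = 0}) \<le> (\<Sum>e\<in>S. B)"
    proof (rule sum_mono)
      fix e assume "e \<in> S"
      let ?D = "shortened {e} C"
      from \<open>e \<in> S\<close> have "2 * card ?D \<le> card C"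
        unfolding S_def using card_shortened_half[OF C] by blast
      then have "card ?D < 2 ^ (r + 1)" using step.prems by simp
      moreover have "dense d ?D A"
        by (rule dense_mono[OF step.prems(2)]) (auto simp: shortened_def)
      ultimately have "card {f \<in> ?D. real (wt A f) \<le> a * d} \<le> B"
        unfolding B_def using step.IH is_code_shortened[OF C] by blast
      moreover have "{f \<in> M. f e = 0} = {f \<in> ?D. real (wt A f) \<le> a * d}"
        by (auto simp: M_def shortened_def)
      ultimately show "card {f \<in> M. f e = 0} \<le> B" by simp
    qed
    moreover have "(\<Sum>e\<in>S. card {f \<in> M. f e = 0}) = (\<Sum>f\<in>M. card {e \<in> S. f e = 0})"
      by (rule sum_multicount_gen) (use \<open>finite M\<close> \<open>finite S\<close> in auto)
    moreover have "real (card S) - a * d \<le> card {e \<in> S. f e = 0}" if "f \<in> M" for f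
    proof -
      have "{e \<in> A. f e \<noteq> 0} = {e \<in> S. f e \<noteq> 0}"
        using that by (auto simp: S_def M_def)
      moreover have "card S = card {e \<in> S. f e = 0} + card {e \<in> S. f e \<noteq> 0}"
        using \<open>finite S\<close> by (subst card_Un_disjoint[symmetric]) (auto intro: arg_cong[where f = card])
      ultimately show ?thesis
        using that by (simp add: M_def wt_def)
    qed
    then have "(\<Sum>f\<in>M. real (card S) - a * d) \<le> (\<Sum>f\<in>M. real (card {e \<in> S. f e = 0}))"
      by (rule sum_mono)
    ultimately have "card M * (real (card S) - a * d) \<le> card S * real B"
      by (simp flip: of_nat_sum of_nat_mult)
    moreover have "card S * (real (r + 1) - a) \<le> (r + 1) * (real (card S) - a * d)"
      using mult_left_mono[OF S, of a] by (simp add: algebra_simps)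
    ultimately have "card M * (card S * (real (r + 1) - a)) \<le> (r + 1) * (card S * real B)"
      by (smt (verit) mult.left_commute mult_left_mono of_nat_0_le_iff)
    then have "card S * (card M * (real (r + 1) - a)) \<le> card S * ((r + 1) * real B)"
      by (simp add: algebra_simps)
    moreover have "0 < real (card S)"
      using S assms(4) by (smt (verit) mult_pos_pos of_nat_0_less_iff zero_less_Suc add.commute plus_1_eq_Suc)
    ultimately have "card M * (real (r + 1) - a) \<le> (r + 1) * real B"
      by simp
    also have "(r + 1) * real B = 2 ^ (a + 1) * ((r + 1) * (r choose a))"
      by (simp add: B_def algebra_simps)
    \<comment> \<open>The counting loses a factor (r + 1) / (r + 1 - a), which is exactly the growth
      of the binomial coefficient.\<close>
    also have "(r + 1) * (r choose a) = (Suc r - a) * (Suc r choose a)"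
      using binomial_absorb_comp[of "Suc r" a] by simp
    also have "real (2 ^ (a + 1) * ((Suc r - a) * (Suc r choose a)))
        = 2 ^ (a + 1) * (Suc r choose a) * (real (r + 1) - a)"
      using step.hyps by (simp add: of_nat_diff)
    finally have "real (card M) \<le> 2 ^ (a + 1) * (Suc r choose a)"
      using step.hyps by simp
    then show ?thesis unfolding M_def by linarith
  qed
qed

text \<open>An \<open>a\<close>-th power, valid for every \<open>a\<close>, can be absorbed by a
  geometric series. For \<open>a > r\<close> the whole code is already small enough.\<close>

lemma card_light_words_le:
  assumes "is_code C" "dense d C A" "finite A" "0 < d" "card C < 2 ^ (r + 1)" "1 \<le> r"
  shows "card {f \<in> C. real (wt A f) \<le> a * d} \<le> 2 * (2 * r) ^ a"
proof (cases "a \<le> r")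
  case True
  then have "2 ^ (a + 1) * (r choose a) \<le> 2 ^ (a + 1) * r ^ a"
    using binomial_le_pow by simp
  also have "\<dots> = 2 * (2 * r) ^ a" by (simp add: power_mult_distrib)
  finally show ?thesis
    using card_light_words_le_choose[OF assms(1-5) True] by linarith
next
  case False
  have "card {f \<in> C. real (wt A f) \<le> a * d} \<le> card C"
    using assms is_codeD(1) by (intro card_mono) auto
  also have "card C \<le> 2 ^ (r + 1)" using assms by simp
  also have "\<dots> \<le> 2 ^ a" using False by (intro power_increasing) auto
  also have "\<dots> \<le> (2 * r) ^ a" using assms by (intro power_mono) auto
  finally show ?thesis by simp
qed

subsection \<open>Sparsifying codes\<close>

lemma sum_inverse_power8: "(\<Sum>a=1..n. (1 / 8 :: real) ^ a) \<le> 1 / 7"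
proof -
  have "(1 - q) * (\<Sum>a=1..n. q ^ a) = q - q * q ^ n" for q :: real
  proof (induction n)
    case (Suc n)
    have "(1 - q) * (\<Sum>a=1..Suc n. q ^ a) = (1 - q) * (\<Sum>a=1..n. q ^ a) + (1 - q) * (q * q ^ n)"
      by (simp add: distrib_left)
    also have "\<dots> = q - q * q ^ Suc n"
      unfolding Suc.IH by (simp add: left_diff_distrib)
    finally show ?case .
  qed simp
  from this[of "1 / 8"] have "7 * (\<Sum>a=1..n. (1 / 8 :: real) ^ a) = 1 - (1 / 8) ^ n" by simp
  moreover have "0 \<le> (1 / 8 :: real) ^ n" by simp
  ultimately show ?thesis by linarith
qed

text \<open>The failure probability in the union bound, with the factor 2 for the two tails. Words
  are layered by \<open>a\<close>, the integer part of weight over \<open>d\<close>; density empties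
  layer 0. Layer \<open>a\<close> has at most 2 (4 r^2)^a words, each contributing at most (32
  r^2)^(-a), and the terms 2 / 8^a add up to at most 2/7.\<close>

lemma sum_exp_wt_less:
  fixes C :: "('e \<Rightarrow> 'g::ab_group_add) set" and d b :: real
  assumes C: "is_code C" and A: "dense d C A" "finite A" and d: "0 < d"
    and r: "card C < 2 ^ (r + 1)" "1 \<le> r" and b: "0 \<le> b" "exp (- (b * d)) \<le> 1 / (32 * (real r)\<^sup>2)"
  shows "2 * (\<Sum>f \<in> C - {\<lambda>_. 0}. exp (- (b * wt A f))) < 1"
proof -
  define h where "h = (\<lambda>f :: 'e \<Rightarrow> 'g. nat \<lfloor>wt A f / d\<rfloor>)"
  define n where "n = nat \<lfloor>card A / d\<rfloor>"
  let ?S = "C - {\<lambda>_. 0}"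
  have fin: "finite ?S" using is_codeD(1)[OF C] by simp
  have h: "h f * d \<le> wt A f" "wt A f < (h f + 1) * d" "1 \<le> h f" "h f \<le> n" if "f \<in> ?S" for f
  proof -
    have "d \<le> wt A f" using dense_wt_ge[OF C A(1)] d that by auto
    then have 1: "1 \<le> wt A f / d" using d by simp
    then have "real (h f) = of_int \<lfloor>wt A f / d\<rfloor>" by (simp add: h_def)
    then have "h f \<le> wt A f / d" "wt A f / d < h f + 1" by linarith+
    then show "h f * d \<le> wt A f" "wt A f < (h f + 1) * d"
      using d by (simp_all add: field_simps)
    show "1 \<le> h f" using 1 by (simp add: h_def le_nat_iff)
    have "wt A f \<le> card A" unfolding wt_def using A(2) by (intro card_mono) auto
    then show "h f \<le> n" unfolding h_def n_def
      using d by (intro nat_mono floor_mono divide_right_mono) auto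
  qed
  have layer: "(\<Sum>f\<in>{f \<in> ?S. h f = a}. exp (- (b * wt A f))) \<le> 2 * (1 / 8) ^ a"
    if a: "1 \<le> a" for a
  proof -
    have "{f \<in> ?S. h f = a} \<subseteq> {f \<in> C. real (wt A f) \<le> real (a + 1) * d}"
      using h(2) by fastforce
    then have "card {f \<in> ?S. h f = a} \<le> card {f \<in> C. real (wt A f) \<le> real (a + 1) * d}"
      using is_codeD(1)[OF C] by (intro card_mono) auto
    also have "\<dots> \<le> 2 * (2 * r) ^ (a + 1)"
      using card_light_words_le[OF C A d r] by blast
    also have "\<dots> \<le> 2 * (2 * r) ^ (2 * a)"
      using r a by (intro mult_left_mono power_increasing) auto
    finally have "real (card {f \<in> ?S. h f = a}) \<le> real (2 * (2 * r) ^ (2 * a))"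
      by (rule of_nat_mono)
    also have "\<dots> = 2 * (4 * (real r)\<^sup>2) ^ a"
      by (simp add: power_mult power_mult_distrib)
    finally have N: "real (card {f \<in> ?S. h f = a}) \<le> 2 * (4 * (real r)\<^sup>2) ^ a" .
    have "exp (- (b * wt A f)) \<le> (1 / (32 * (real r)\<^sup>2)) ^ a" if "f \<in> {f \<in> ?S. h f = a}" for f
    proof -
      have "b * (a * d) \<le> b * wt A f"
        using h(1)[of f] that b by (intro mult_left_mono) auto
      then have "exp (- (b * wt A f)) \<le> exp (real a * (- (b * d)))" by (simp add: algebra_simps)
      also have "\<dots> = exp (- (b * d)) ^ a" by (simp only: exp_of_nat_mult)
      also have "\<dots> \<le> (1 / (32 * (real r)\<^sup>2)) ^ a" using b by (intro power_mono) auto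
      finally show ?thesis .
    qed
    then have "(\<Sum>f\<in>{f \<in> ?S. h f = a}. exp (- (b * wt A f)))
        \<le> card {f \<in> ?S. h f = a} * (1 / (32 * (real r)\<^sup>2)) ^ a"
      by (rule sum_bounded_above)
    also have "\<dots> \<le> 2 * (4 * (real r)\<^sup>2) ^ a * (1 / (32 * (real r)\<^sup>2)) ^ a"
      using N by (intro mult_right_mono) auto
    also have "\<dots> = 2 * ((4 * (real r)\<^sup>2) * (1 / (32 * (real r)\<^sup>2))) ^ a"
      by (simp only: power_mult_distrib mult.assoc)
    also have "(4 * (real r)\<^sup>2) * (1 / (32 * (real r)\<^sup>2)) = 1 / 8"
      using r by (simp add: field_simps)
    finally show ?thesis .
  qed
  have "(\<Sum>f\<in>?S. exp (- (b * wt A f)))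
      = (\<Sum>a=1..n. \<Sum>f\<in>{f \<in> ?S. h f = a}. exp (- (b * wt A f)))"
    by (rule sum.group[symmetric]) (use fin h(3,4) in \<open>simp_all add: image_subset_iff\<close>)
  also have "\<dots> \<le> (\<Sum>a=1..n. 2 * (1 / 8) ^ a)"
    by (rule sum_mono) (use layer in auto)
  also have "\<dots> \<le> 2 * (1 / 7)"
    unfolding sum_distrib_left[symmetric] using sum_inverse_power8 by (intro mult_left_mono) auto
  finally show ?thesis by simp
qed

lemma exp_add_exp_minus_le:
  fixes x :: real
  assumes "\<bar>x\<bar> \<le> 1"
  shows "exp x + exp (- x) \<le> 2 * exp (x\<^sup>2)"
proof -
  have *: "exp y \<le> 1 + y + y\<^sup>2" if "\<bar>y\<bar> \<le> 1" for y :: real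
  proof (cases "0 \<le> y")
    case True
    then show ?thesis using exp_bound that by auto
  next
    case False
    define z where "z = - y"
    have z: "0 < z" "z \<le> 1" using False that by (auto simp: z_def)
    \<comment> \<open>The product is \<open>1 + z ^ 3\<close>.\<close>
    have "1 \<le> (1 + z) * (1 - z + z\<^sup>2)"
      using z by (simp add: algebra_simps power2_eq_square)
    also have "\<dots> \<le> exp z * (1 - z + z\<^sup>2)"
      using z exp_ge_add_one_self[of z] by (intro mult_right_mono) auto
    finally have "exp (- z) \<le> 1 - z + z\<^sup>2"
      by (simp add: exp_minus field_simps)
    then show ?thesis by (simp add: z_def)
  qed
  have "exp x + exp (- x) \<le> (1 + x + x\<^sup>2) + (1 + - x + (- x)\<^sup>2)"
    using *[of x] *[of "- x"] assms by linarith
  also have "\<dots> = 2 * (1 + x\<^sup>2)" by simp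
  also have "\<dots> \<le> 2 * exp (x\<^sup>2)"
    using exp_ge_add_one_self by (intro mult_left_mono) auto
  finally show ?thesis .
qed

text \<open>Moment generating function of a Rademacher sum: the subset \<open>B\<close> plays the role of the signs,
  and \<open>2 * wt B f - wt A f\<close> is the signed sum over the support of \<open>f\<close>.\<close>

lemma sum_Pow_exp_wt_le:
  fixes x :: real
  assumes A: "finite A" and "\<bar>x\<bar> \<le> 1"
  shows "(\<Sum>B\<in>Pow A. exp (x * (2 * real (wt B f) - wt A f))) \<le> 2 ^ card A * exp (x\<^sup>2 * wt A f)"
proof -
  define s where "s = (\<lambda>e (y::real). if f e \<noteq> 0 then exp y else 1)"
  have prod_s: "(\<Prod>e\<in>B. s e y) = exp (y * wt B f)" if "finite B" for B y
  proof -
    have "(\<Prod>e\<in>B. s e y) = (\<Prod>e\<in>{e \<in> B. f e \<noteq> 0}. exp y)"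
      unfolding s_def using that by (subst prod.inter_filter) auto
    then show ?thesis by (simp add: wt_def exp_of_nat2_mult)
  qed
  have "(\<Sum>B\<in>Pow A. exp (x * (2 * real (wt B f) - wt A f)))
      = (\<Sum>B\<in>Pow A. (\<Prod>e\<in>B. s e x) * (\<Prod>e\<in>A-B. s e (- x)))"
  proof (rule sum.cong[OF refl])
    fix B assume B: "B \<in> Pow A"
    then have "finite B" using A finite_subset by auto
    have "{e \<in> A. f e \<noteq> 0} = {e \<in> B. f e \<noteq> 0} \<union> {e \<in> A - B. f e \<noteq> 0}" using B by auto
    then have "wt A f = wt B f + wt (A - B) f"
      unfolding wt_def using A \<open>finite B\<close> by (simp add: card_Un_disjoint disjoint_iff)
    then have "x * (2 * real (wt B f) - wt A f) = x * wt B f + (- x) * wt (A - B) f"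
      by (simp add: algebra_simps)
    then show "exp (x * (2 * real (wt B f) - wt A f)) = (\<Prod>e\<in>B. s e x) * (\<Prod>e\<in>A-B. s e (- x))"
      using A \<open>finite B\<close> by (simp only: prod_s finite_Diff exp_add)
  qed
  \<comment> \<open>Independence of the signs: expanding the product chooses for each coordinate
    whether it lies in \<open>B\<close>.\<close>
  also have "\<dots> = (\<Prod>e\<in>A. s e x + s e (- x))"
    by (rule prod_add[OF A, symmetric])
  also have "\<dots> \<le> (\<Prod>e\<in>A. 2 * s e (x\<^sup>2))"
    by (rule prod_mono) (use exp_add_exp_minus_le[OF assms(2)] in \<open>auto simp: s_def add_nonneg_nonneg\<close>)
  also have "\<dots> = 2 ^ card A * exp (x\<^sup>2 * wt A f)"
    by (simp add: prod.distrib prod_s[OF A])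
  finally show ?thesis .
qed

text \<open>A first moment argument: a potential that detects every failing word averages below 1
  over all subsets of \<open>A\<close>, so some subset has no failing word.\<close>

lemma exists_halving:
  fixes C :: "('e \<Rightarrow> 'g::ab_group_add) set" and d \<epsilon> :: real
  assumes C: "is_code C" and A: "dense d C A" "finite A" and d: "0 < d"
    and r: "card C < 2 ^ (r + 1)" "1 \<le> r" and \<epsilon>: "0 < \<epsilon>" "\<epsilon> \<le> 1"
    and ex: "exp (- (\<epsilon>\<^sup>2 / 4 * d)) \<le> 1 / (32 * (real r)\<^sup>2)"
  obtains B where "B \<subseteq> A" "2 * card B \<le> card A"
    "\<And>f. f \<in> C \<Longrightarrow> \<bar>2 * real (wt B f) - wt A f\<bar> \<le> \<epsilon> * wt A f"
proof -
  \<comment> \<open>This minimises the Chernoff exponent \<open>x^2 - x * \<epsilon>\<close>, with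
    value \<open>- \<epsilon>^2 / 4\<close>.\<close>
  define x where "x = \<epsilon> / 2"
  let ?S = "C - {\<lambda>_. 0}"
  define Z where "Z = (\<lambda>B f. 2 * real (wt B f) - wt A (f :: 'e \<Rightarrow> 'g))"
  \<comment> \<open>One of the two terms reaches 1 as soon as the deviation in its direction reaches
    \<open>\<epsilon> * wt A f\<close>.\<close>
  define \<Phi> where "\<Phi> = (\<lambda>B f. (exp (x * Z B f) + exp (- x * Z B f)) * exp (- (x * \<epsilon> * wt A f)))"
  have fin: "finite ?S" using is_codeD(1)[OF C] by simp
  have word: "(\<Sum>B\<in>Pow A. \<Phi> B f) \<le> 2 ^ card A * (2 * exp (- (\<epsilon>\<^sup>2 / 4 * wt A f)))" for f
  proof -
    have "(\<Sum>B\<in>Pow A. \<Phi> B f)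
        = ((\<Sum>B\<in>Pow A. exp (x * Z B f)) + (\<Sum>B\<in>Pow A. exp (- x * Z B f))) * exp (- (x * \<epsilon> * wt A f))"
      unfolding \<Phi>_def sum_distrib_right[symmetric] sum.distrib ..
    also have "\<dots> \<le> (2 ^ card A * exp (x\<^sup>2 * wt A f) + 2 ^ card A * exp ((- x)\<^sup>2 * wt A f))
        * exp (- (x * \<epsilon> * wt A f))"
      unfolding Z_def using \<epsilon> A(2)
      by (intro mult_right_mono add_mono sum_Pow_exp_wt_le) (auto simp: x_def)
    also have "\<dots> = 2 ^ card A * (2 * (exp (x\<^sup>2 * wt A f) * exp (- (x * \<epsilon> * wt A f))))"
      by simp
    also have "exp (x\<^sup>2 * wt A f) * exp (- (x * \<epsilon> * wt A f)) = exp (- (\<epsilon>\<^sup>2 / 4 * wt A f))"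
      unfolding exp_add[symmetric] x_def by (simp add: field_simps power2_eq_square)
    finally show ?thesis .
  qed
  have "(\<Sum>B\<in>Pow A. \<Sum>f\<in>?S. \<Phi> B f) = (\<Sum>f\<in>?S. \<Sum>B\<in>Pow A. \<Phi> B f)"
    by (rule sum.swap)
  also have "\<dots> \<le> (\<Sum>f\<in>?S. 2 ^ card A * (2 * exp (- (\<epsilon>\<^sup>2 / 4 * wt A f))))"
    by (rule sum_mono[OF word])
  also have "\<dots> = 2 ^ card A * (2 * (\<Sum>f\<in>?S. exp (- (\<epsilon>\<^sup>2 / 4 * wt A f))))"
    by (simp add: sum_distrib_left)
  also have "\<dots> < 2 ^ card A * 1"
    using sum_exp_wt_less[OF C A d r _ ex] by (intro mult_strict_left_mono) auto
  also have "\<dots> = (\<Sum>B\<in>Pow A. 1)"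
    using A(2) by (simp add: card_Pow)
  finally have "\<exists>B\<in>Pow A. (\<Sum>f\<in>?S. \<Phi> B f) < 1"
    by (meson not_less sum_mono)
  then obtain B where B: "B \<subseteq> A" and sum1: "(\<Sum>f\<in>?S. \<Phi> B f) < 1"
    by auto
  have dev: "\<bar>Z B f\<bar> \<le> \<epsilon> * wt A f" if "f \<in> C" for f
  proof (cases "f = (\<lambda>_. 0)")
    case True
    then show ?thesis by (simp add: Z_def wt_def)
  next
    case False
    then have "\<Phi> B f \<le> (\<Sum>f\<in>?S. \<Phi> B f)"
      using that fin by (intro member_le_sum) (auto simp: \<Phi>_def)
    with sum1 have lt1: "\<Phi> B f < 1" by simp
    have "\<Phi> B f = exp (x * Z B f - x * \<epsilon> * wt A f) + exp (- x * Z B f - x * \<epsilon> * wt A f)"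
      unfolding \<Phi>_def by (simp add: distrib_right flip: exp_add)
    with lt1 have "exp (x * Z B f - x * \<epsilon> * wt A f) < 1" "exp (- x * Z B f - x * \<epsilon> * wt A f) < 1"
      using exp_gt_zero[of "x * Z B f - x * \<epsilon> * wt A f"] exp_gt_zero[of "- x * Z B f - x * \<epsilon> * wt A f"]
      by linarith+
    then have "x * Z B f < x * (\<epsilon> * wt A f)" "x * (- Z B f) < x * (\<epsilon> * wt A f)"
      by simp_all
    then have "Z B f < \<epsilon> * wt A f" "- Z B f < \<epsilon> * wt A f"
      using \<epsilon>(1) mult_less_cancel_left_pos[of x] unfolding x_def by fastforce+
    then show ?thesis by linarith
  qed
  \<comment> \<open>The two-sided bound is symmetric in \<open>B\<close> and its complement, so the smaller half can be kept.\<close>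
  show ?thesis
  proof (cases "2 * card B \<le> card A")
    case True
    then show ?thesis using that B dev by (simp add: Z_def)
  next
    case False
    have "finite B" using B A(2) finite_subset by blast
    have "card (A - B) = card A - card B" using B \<open>finite B\<close> by (simp add: card_Diff_subset)
    moreover have "real (wt (A - B) f) = wt A f - wt B f" for f :: "'e \<Rightarrow> 'g"
    proof -
      have "{e \<in> A. f e \<noteq> 0} = {e \<in> B. f e \<noteq> 0} \<union> {e \<in> A - B. f e \<noteq> 0}" using B by auto
      then have "wt A f = wt B f + wt (A - B) f"
        unfolding wt_def using A(2) \<open>finite B\<close> by (simp add: card_Un_disjoint disjoint_iff)
      then show ?thesis by simp
    qed
    then have "\<bar>2 * real (wt (A - B) f) - wt A f\<bar> \<le> \<epsilon> * wt A f" if "f \<in> C" for f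
      using dev[OF that] unfolding Z_def by simp
    ultimately show ?thesis using that[of "A - B"] False by auto
  qed
qed

text \<open>While some subcode violates density, its support is deleted. That costs fewer than
  \<open>d\<close> times the rank of the subcode in coordinates, and restriction then loses this
  rank, so all deletions are charged to the rank of \<open>C\<close>.\<close>

lemma exists_dense_part:
  fixes C :: "('e \<Rightarrow> 'g::ab_group_add) set" and d :: real
  assumes "is_code C" "finite E" "0 < d"
  shows "\<exists>S\<subseteq>E. card S \<le> d * log 2 (card C) \<and> dense d (restr (E - S) ` C) (E - S)"
  using assms(1,2)
proof (induction "card E" arbitrary: C E rule: less_induct)
  case less
  note C = \<open>is_code C\<close>
  let ?D = "restr E ` C"
  have D: "is_code ?D" by (rule is_code_restr[OF C])
  have logD: "log 2 (card ?D) \<le> log 2 (card C)"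
    using card_code_pos[OF D] card_code_pos[OF C] card_image_le[OF is_codeD(1)[OF C], of "restr E"] by simp
  show ?case
  proof (cases "dense d ?D E")
    case True
    have "0 \<le> log 2 (card C)" using card_code_pos[OF C] by simp
    then show ?thesis using True assms(3) by (intro exI[of _ "{}"]) auto
  next
    case False
    then obtain H where H: "H \<subseteq> ?D" "is_code H"
      and sparse: "card {e\<in>E. \<exists>f\<in>H. f e \<noteq> 0} < d * log 2 (card H)"
      unfolding dense_def by (meson not_le)
    define S1 where "S1 = {e\<in>E. \<exists>f\<in>H. f e \<noteq> 0}"
    let ?E = "E - S1"
    \<comment> \<open>Words of \<open>?D\<close> vanish outside \<open>E\<close>, so a subcode
      without support in \<open>E\<close> is trivial, has rank 0 and violates nothing.\<close>
    have "S1 \<noteq> {}"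
    proof
      assume "S1 = {}"
      then have "f = (\<lambda>_. 0)" if "f \<in> H" for f
        using H(1) that by (fastforce simp: S1_def restr_def)
      then have "H \<subseteq> {\<lambda>_. 0}" by blast
      then have "card H \<le> 1" using card_mono[of "{\<lambda>_. 0}" H] by simp
      then have "log 2 (card H) = 0" using card_code_pos[OF H(2)] by (simp add: le_Suc_eq)
      then show False using sparse by simp
    qed
    then have "card ?E < card E"
      using less.prems(2) by (intro psubset_card_mono) (auto simp: S1_def)
    then obtain S2 where S2: "S2 \<subseteq> ?E" "card S2 \<le> d * log 2 (card (restr ?E ` ?D))"
      "dense d (restr (?E - S2) ` restr ?E ` ?D) (?E - S2)"
      using less.hyps[of ?E "restr ?E ` ?D"] less.prems(2) is_code_restr[OF D] by blast
    \<comment> \<open>Every word of \<open>H\<close> vanishes outside \<open>S1\<close>, so \<open>H\<close> is lost when restricting to \<open>E - S1\<close>.\<close>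
    have "H \<subseteq> shortened ?E ?D" using H(1) by (auto simp: shortened_def S1_def)
    then have "log 2 (card (restr ?E ` ?D)) + log 2 (card H) \<le> log 2 (card C)"
      using log_card_restr_shortened_le[OF D H(2)] logD by fastforce
    then have "d * (log 2 (card (restr ?E ` ?D)) + log 2 (card H)) \<le> d * log 2 (card C)"
      using assms(3) by (intro mult_left_mono) auto
    moreover have "card (S1 \<union> S2) \<le> card S1 + card S2" by (rule card_Un_le)
    then have "real (card (S1 \<union> S2)) \<le> real (card S1) + card S2" by linarith
    ultimately have "card (S1 \<union> S2) \<le> d * log 2 (card C)"
      using S2(2) sparse unfolding S1_def[symmetric] by (simp add: distrib_left)
    moreover have "restr (?E - S2) ` restr ?E ` ?D = restr (E - (S1 \<union> S2)) ` C"
      unfolding image_image restr_restr by (intro image_cong arg_cong2[where f = restr]) auto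
    moreover have "?E - S2 = E - (S1 \<union> S2)" by blast
    moreover have "S1 \<union> S2 \<subseteq> E" using S2(1) by (auto simp: S1_def)
    ultimately show ?thesis using S2(3) by (intro exI[of _ "S1 \<union> S2"]) simp
  qed
qed

section \<open>Repeated halving for unit multiplicities\<close>

definition wsum :: "('e \<Rightarrow> real) \<Rightarrow> 'e set \<Rightarrow> ('e \<Rightarrow> 'g::zero) \<Rightarrow> real" where
  "wsum w A f = (\<Sum>e\<in>{e \<in> A. f e \<noteq> 0}. w e)"

lemma wsum_restr: "B \<subseteq> A \<Longrightarrow> wsum w B (restr A f) = wsum w B f"
  unfolding wsum_def restr_def by (rule sum.cong) auto

lemma wsum_Un_disjoint:
  assumes "finite A" "finite B" "A \<inter> B = {}"
  shows "wsum w (A \<union> B) f = wsum w A f + wsum w B f"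
proof -
  have "{e \<in> A \<union> B. f e \<noteq> 0} = {e \<in> A. f e \<noteq> 0} \<union> {e \<in> B. f e \<noteq> 0}" by auto
  then show ?thesis
    unfolding wsum_def using assms by (simp add: sum.union_disjoint disjoint_iff)
qed

lemma wsum_const: "wsum (\<lambda>_. x) A f = x * wt A f"
  by (simp add: wsum_def wt_def)

text \<open>In each of \<open>t\<close> rounds the removed coordinates keep their weight, and the
  surviving half of the dense rest is doubled. The bound \<open>2 ^ t\<close> on the weights limits
  the error on words outside the code, which matters when digits are combined.\<close>

lemma exists_sparsifier_uniform:
  fixes C :: "('e \<Rightarrow> 'g::ab_group_add) set" and d \<epsilon> :: real
  assumes C: "is_code C" and "finite E" "card E < 2 ^ t" and d: "0 < d"
    and r: "card C < 2 ^ (r + 1)" "1 \<le> r" and \<epsilon>: "0 < \<epsilon>" "\<epsilon> \<le> 1"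
    and ex: "exp (- (\<epsilon>\<^sup>2 / 4 * d)) \<le> 1 / (32 * (real r)\<^sup>2)"
  shows "\<exists>w :: 'e \<Rightarrow> real. (\<forall>e. 0 \<le> w e \<and> w e \<le> 2 ^ t) \<and> (\<forall>e. e \<notin> E \<longrightarrow> w e = 0)
      \<and> card {e\<in>E. w e \<noteq> 0} \<le> t * (d * log 2 (card C))
      \<and> (\<forall>f\<in>C. \<bar>wsum w E f - wt E f\<bar> \<le> ((1 + \<epsilon>) ^ t - 1) * wt E f)"
  using C assms(2,3) r(1)
proof (induction t arbitrary: C E)
  case 0
  then have "E = {}" by simp
  then show ?case by (intro exI[of _ "\<lambda>_. 0"]) (simp add: wsum_def wt_def)
next
  case (Suc t)
  note C = \<open>is_code C\<close> and E = \<open>finite E\<close>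
  obtain S where S: "S \<subseteq> E" "card S \<le> d * log 2 (card C)"
    and dense: "dense d (restr (E - S) ` C) (E - S)"
    using exists_dense_part[OF C E d] by blast
  define R where "R = E - S"
  let ?D = "restr R ` C"
  have D: "is_code ?D" by (rule is_code_restr[OF C])
  have "card ?D \<le> card C" by (rule card_image_le[OF is_codeD(1)[OF C]])
  then have rD: "card ?D < 2 ^ (r + 1)" using Suc.prems by linarith
  have finR: "finite R" "finite S" using E S(1) finite_subset by (auto simp: R_def)
  obtain B where B: "B \<subseteq> R" "2 * card B \<le> card R"
    and dev: "\<And>f. f \<in> ?D \<Longrightarrow> \<bar>2 * real (wt B f) - wt R f\<bar> \<le> \<epsilon> * wt R f"
    using exists_halving[OF D _ finR(1) d rD r(2) \<epsilon> ex] dense unfolding R_def by blast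
  have "card R \<le> card E" using E by (intro card_mono) (auto simp: R_def)
  then have cardB: "card B < 2 ^ t" using B(2) Suc.prems by simp
  have finB: "finite B" using B(1) finR(1) finite_subset by blast
  obtain w where w: "\<And>e. 0 \<le> w e \<and> w e \<le> 2 ^ t" "\<And>e. e \<notin> B \<Longrightarrow> w e = 0"
    "card {e\<in>B. w e \<noteq> 0} \<le> t * (d * log 2 (card C))"
    "\<And>f. f \<in> C \<Longrightarrow> \<bar>wsum w B f - wt B f\<bar> \<le> ((1 + \<epsilon>) ^ t - 1) * wt B f"
    using Suc.IH[OF C finB cardB Suc.prems(4)] by blast
  define v where "v = (\<lambda>e. if e \<in> S then 1 else 2 * w e)"
  have SB: "S \<inter> B = {}" using B(1) by (auto simp: R_def)
  have v0: "v e = 0" if "e \<notin> S \<union> B" for e using that w(2) by (simp add: v_def)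
  have split: "wsum v E f = wt S f + 2 * wsum w B f" for f :: "'e \<Rightarrow> 'g"
  proof -
    have "wsum v E f = wsum v (S \<union> B) f"
      unfolding wsum_def using S(1) B(1) E v0
      by (intro sum.mono_neutral_right) (auto simp: R_def)
    also have "\<dots> = wsum v S f + wsum v B f"
      by (rule wsum_Un_disjoint[OF finR(2) finB SB])
    also have "wsum v S f = wsum (\<lambda>_. 1) S f"
      unfolding wsum_def v_def by (rule sum.cong) auto
    also have "wsum v B f = 2 * wsum w B f"
      unfolding wsum_def sum_distrib_left v_def using SB by (intro sum.cong) auto
    finally show ?thesis by (simp add: wsum_const)
  qed
  have wtE: "real (wt E f) = wt S f + wt R f" for f :: "'e \<Rightarrow> 'g"
  proof -
    have "E = S \<union> R" "S \<inter> R = {}" using S(1) by (auto simp: R_def)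
    then show ?thesis
      using wsum_Un_disjoint[OF finR(2) finR(1), of "\<lambda>_. 1" f] by (simp add: wsum_const)
  qed
  show ?case
  proof (intro exI[of _ v] conjI allI ballI impI)
    fix e
    show "0 \<le> v e" using w(1) by (simp add: v_def)
    have "2 * w e \<le> 2 ^ Suc t" using w(1)[of e] by simp
    moreover have "1 \<le> (2::real) ^ Suc t" by (rule one_le_power) simp
    ultimately show "v e \<le> 2 ^ Suc t" by (simp add: v_def)
  next
    fix e assume "e \<notin> E"
    then show "v e = 0" using v0 S(1) B(1) by (auto simp: R_def)
  next
    have "{e \<in> E. v e \<noteq> 0} \<subseteq> S \<union> {e \<in> B. w e \<noteq> 0}"
      using w(2) by (auto simp: v_def split: if_splits)
    then have "card {e \<in> E. v e \<noteq> 0} \<le> card (S \<union> {e \<in> B. w e \<noteq> 0})"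
      using finR(2) finB by (intro card_mono) auto
    also have "\<dots> \<le> card S + card {e \<in> B. w e \<noteq> 0}" by (rule card_Un_le)
    finally have "real (card {e \<in> E. v e \<noteq> 0}) \<le> real (card S) + card {e \<in> B. w e \<noteq> 0}"
      by linarith
    then show "card {e \<in> E. v e \<noteq> 0} \<le> Suc t * (d * log 2 (card C))"
      using S(2) w(3) by (simp add: algebra_simps)
  next
    fix f assume f: "f \<in> C"
    define q where "q = (1 + \<epsilon>) ^ t"
    have "1 \<le> q" unfolding q_def using \<epsilon> by (intro one_le_power) simp
    have half: "\<bar>2 * real (wt B f) - wt R f\<bar> \<le> \<epsilon> * wt R f"
      using dev[of "restr R f"] f B(1) by (simp add: wt_restr)
    have rec: "\<bar>wsum w B f - wt B f\<bar> \<le> (q - 1) * wt B f"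
      using w(4)[OF f] by (simp add: q_def)
    \<comment> \<open>The recursive error is relative to \<open>wt B f\<close>, so the errors
      compound multiplicatively: (q - 1)(1 + \<epsilon>) + \<epsilon> = (1 + \<epsilon>) q -
      1.\<close>
    have "(q - 1) * (2 * real (wt B f)) \<le> (q - 1) * ((1 + \<epsilon>) * wt R f)"
      using half \<open>1 \<le> q\<close> by (intro mult_left_mono) (auto simp: algebra_simps)
    then have "\<bar>2 * wsum w B f - wt R f\<bar> \<le> (q - 1) * ((1 + \<epsilon>) * wt R f) + \<epsilon> * wt R f"
      using half rec by linarith
    also have "\<dots> = ((1 + \<epsilon>) * q - 1) * wt R f"
      by (simp add: algebra_simps)
    also have "\<dots> \<le> ((1 + \<epsilon>) * q - 1) * wt E f"
      using \<open>1 \<le> q\<close> \<epsilon> mult_mono[of 1 "1 + \<epsilon>" 1 q] by (intro mult_left_mono) (auto simp: wtE)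
    finally show "\<bar>wsum v E f - wt E f\<bar> \<le> ((1 + \<epsilon>) ^ Suc t - 1) * wt E f"
      by (simp add: split wtE q_def)
  qed
qed

section \<open>Arbitrary multiplicities through binary digits\<close>

lemma sum_bits_eq:
  fixes u :: nat
  shows "u < 2 ^ N \<Longrightarrow> u = (\<Sum>i\<in>{i. i < N \<and> odd (u div 2 ^ i)}. 2 ^ i)"
proof (induction N arbitrary: u)
  case (Suc N)
  have "u div 2 < 2 ^ N" using Suc.prems by simp
  note IH = Suc.IH[OF this]
  have eq: "{i. i < Suc N \<and> odd (u div 2 ^ i)}
      = {i. i = 0 \<and> odd u} \<union> Suc ` {i. i < N \<and> odd (u div 2 div 2 ^ i)}"
    by (auto simp: image_iff less_Suc_eq_0_disj div_mult2_eq)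
  have "(\<Sum>i\<in>{i. i < Suc N \<and> odd (u div 2 ^ i)}. 2 ^ i)
      = (\<Sum>i\<in>{i. i = 0 \<and> odd u}. 2 ^ i) + (\<Sum>i\<in>Suc ` {i. i < N \<and> odd (u div 2 div 2 ^ i)}. 2 ^ i)"
    unfolding eq by (rule sum.union_disjoint) auto
  also have "(\<Sum>i\<in>{i. i = 0 \<and> odd u}. 2 ^ i) = u mod 2"
    by (cases "odd u") (auto simp: odd_iff_mod_2_eq_one)
  also have "(\<Sum>i\<in>Suc ` {i. i < N \<and> odd (u div 2 div 2 ^ i)}. 2 ^ i)
      = 2 * (\<Sum>i\<in>{i. i < N \<and> odd (u div 2 div 2 ^ i)}. 2 ^ i :: nat)"
    by (simp add: sum.reindex sum_distrib_left)
  also have "\<dots> = 2 * (u div 2)" by (simp only: IH[symmetric])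
  finally show ?case by simp
qed simp

text \<open>Each unit of shift telescopes to one boundary difference. The bound is free of
  \<open>N\<close>, which keeps the number of digits out of the final count.\<close>

lemma sum_shift_diff_le:
  fixes q :: "nat \<Rightarrow> real"
  assumes "\<And>i. 0 \<le> q i" "\<And>i. q i \<le> b"
  shows "(\<Sum>i<N. q (i + L) - q i) \<le> L * b"
proof (induction L)
  case (Suc L)
  have "(\<Sum>i<N. q (i + Suc L) - q i)
      = (\<Sum>i<N. q (i + L) - q i) + (\<Sum>i<N. q (Suc i + L) - q (i + L))"
    by (simp add: sum.distrib[symmetric])
  also have "(\<Sum>i<N. q (Suc i + L) - q (i + L)) = q (N + L) - q L"
    by (subst sum_lessThan_telescope[where f = "\<lambda>i. q (i + L)"]) simp
  also have "\<dots> \<le> b" using assms(1)[of L] assms(2)[of "N + L"] by linarith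
  finally show ?case using Suc.IH by (simp add: algebra_simps)
qed simp

text \<open>Split the weights into binary digits. For the digit \<open>i\<close> only the words that vanish on all
  digits \<open>\<ge> i + L\<close> matter, since the other words have total weight at least \<open>2 ^ (i + L)\<close>; the ranks
  of these codes, restricted to the coordinates with digit \<open>i\<close>, add up to at most \<open>L\<close> times the rank
  of the whole code.\<close>

lemma exists_sparsifier_weighted:
  fixes C :: "('e \<Rightarrow> 'g::ab_group_add) set" and d \<epsilon> :: real and u :: "'e \<Rightarrow> nat"
  assumes C: "is_code C" and U: "finite U" "card U < 2 ^ t" and d: "0 < d"
    and r: "card C < 2 ^ (r + 1)" "1 \<le> r" and \<epsilon>: "0 < \<epsilon>" "\<epsilon> \<le> 1"
    and ex: "exp (- (\<epsilon>\<^sup>2 / 4 * d)) \<le> 1 / (32 * (real r)\<^sup>2)"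
    and \<delta>: "(1 + \<epsilon>) ^ t - 1 \<le> \<delta> / 2" and L: "4 * 4 ^ t \<le> \<delta> * 2 ^ L"
  shows "\<exists>w :: 'e \<Rightarrow> real. (\<forall>e. 0 \<le> w e)
      \<and> card {e\<in>U. w e \<noteq> 0} \<le> t * d * L * log 2 (card C)
      \<and> (\<forall>f\<in>C. \<bar>wsum w U f - wsum u U f\<bar> \<le> \<delta> * wsum u U f)"
proof -
  define N where "N = Suc (\<Sum>e\<in>U. u e)"
  define E where "E = (\<lambda>i. {e \<in> U. odd (u e div 2 ^ i)})"
  define Q where "Q = (\<lambda>i. {f \<in> C. \<forall>j\<in>{i..<N}. \<forall>e\<in>E j. f e = 0})"
  define q where "q = (\<lambda>i. log 2 (card (Q i)))"
  have fin: "finite (E i)" for i using U(1) by (simp add: E_def)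
  have uN: "u e < 2 ^ N" if "e \<in> U" for e
  proof -
    have "u e \<le> (\<Sum>e\<in>U. u e)" using that U(1) by (intro member_le_sum) auto
    then have "u e < N" by (simp add: N_def)
    then show ?thesis using less_exp[of N] by linarith
  qed
  have Q: "is_code (Q i)" for i using C by (auto simp: is_code_def Q_def)
  have q: "0 \<le> q i" "q i \<le> log 2 (card C)" for i
  proof -
    have "card (Q i) \<le> card C" by (rule card_mono) (auto simp: Q_def is_codeD(1)[OF C])
    then show "0 \<le> q i" "q i \<le> log 2 (card C)"
      unfolding q_def using card_code_pos[OF Q[of i]] by simp_all
  qed
  let ?D = "\<lambda>i. restr (E i) ` Q (i + L)"
  \<comment> \<open>Words of \<open>Q i\<close> vanish on \<open>E i\<close>, so they lie in the
    kernel of restricting \<open>Q (i + L)\<close> to \<open>E i\<close>.\<close>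
  have rank: "log 2 (card (?D i)) \<le> q (i + L) - q i" if "i < N" for i
  proof -
    have "Q i \<subseteq> shortened (E i) (Q (i + L))"
      using that by (auto simp: Q_def shortened_def)
    from log_card_restr_shortened_le[OF Q Q this] show ?thesis by (simp add: q_def)
  qed
  let ?good = "\<lambda>i (w :: 'e \<Rightarrow> real). (\<forall>e. 0 \<le> w e \<and> w e \<le> 2 ^ t) \<and> (\<forall>e. e \<notin> E i \<longrightarrow> w e = 0)
      \<and> card {e\<in>E i. w e \<noteq> 0} \<le> t * (d * log 2 (card (?D i)))
      \<and> (\<forall>f\<in>?D i. \<bar>wsum w (E i) f - wt (E i) f\<bar> \<le> ((1 + \<epsilon>) ^ t - 1) * wt (E i) f)"
  have "\<forall>i. \<exists>w. ?good i w"
  proof (rule allI, rule exists_sparsifier_uniform[OF is_code_restr[OF Q] fin _ d _ r(2) \<epsilon> ex])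
    fix i
    have "card (E i) \<le> card U" using U(1) by (intro card_mono) (auto simp: E_def)
    then show "card (E i) < 2 ^ t" using U(2) by simp
    have "card (?D i) \<le> card (Q (i + L))" by (rule card_image_le[OF is_codeD(1)[OF Q]])
    also have "\<dots> \<le> card C" by (rule card_mono) (auto simp: Q_def is_codeD(1)[OF C])
    finally show "card (?D i) < 2 ^ (r + 1)" using r(1) by simp
  qed
  from choice[OF this] obtain w where good: "\<forall>i. ?good i (w i)" ..
  have w: "0 \<le> w i e" "w i e \<le> 2 ^ t" for i e
    using good by blast+
  have w0: "w i e = 0" if "e \<notin> E i" for i e
    using good that by blast
  have cardw: "card {e\<in>E i. w i e \<noteq> 0} \<le> t * (d * log 2 (card (?D i)))" for i
    using good by blast
  have errw: "\<bar>wsum (w i) (E i) f - wt (E i) f\<bar> \<le> ((1 + \<epsilon>) ^ t - 1) * wt (E i) f" if "f \<in> ?D i" for i f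
    using good that by blast
  define v where "v = (\<lambda>e. \<Sum>i<N. 2 ^ i * w i e)"
  have u_eq: "wsum u U f = (\<Sum>i<N. 2 ^ i * real (wt (E i) f))" for f :: "'e \<Rightarrow> 'g"
  proof -
    have "wsum u U f = (\<Sum>e\<in>{e\<in>U. f e \<noteq> 0}. \<Sum>i<N. if odd (u e div 2 ^ i) then 2 ^ i else 0)"
      unfolding wsum_def
    proof (rule sum.cong[OF refl])
      fix e assume "e \<in> {e\<in>U. f e \<noteq> 0}"
      then have "real (u e) = real (\<Sum>i\<in>{i. i < N \<and> odd (u e div 2 ^ i)}. 2 ^ i)"
        using sum_bits_eq[OF uN] by auto
      also have "\<dots> = (\<Sum>i\<in>{i \<in> {..<N}. odd (u e div 2 ^ i)}. 2 ^ i)"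
        by simp
      also have "\<dots> = (\<Sum>i<N. if odd (u e div 2 ^ i) then 2 ^ i else 0)"
        by (rule sum.inter_filter) simp
      finally show "real (u e) = \<dots>" .
    qed
    also have "\<dots> = (\<Sum>i<N. \<Sum>e\<in>{e\<in>U. f e \<noteq> 0}. if odd (u e div 2 ^ i) then 2 ^ i else 0)"
      by (rule sum.swap)
    also have "\<dots> = (\<Sum>i<N. \<Sum>e\<in>{e \<in> {e\<in>U. f e \<noteq> 0}. odd (u e div 2 ^ i)}. 2 ^ i)"
      using U(1) by (intro sum.cong refl sum.inter_filter[symmetric]) simp
    also have "\<dots> = (\<Sum>i<N. 2 ^ i * real (wt (E i) f))"
      unfolding wt_def E_def
      by (intro sum.cong refl) (simp add: conj_commute conj_left_commute)
    finally show ?thesis .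
  qed
  have v_eq: "wsum v U f = (\<Sum>i<N. 2 ^ i * wsum (w i) (E i) f)" for f :: "'e \<Rightarrow> 'g"
  proof -
    have "wsum v U f = (\<Sum>i<N. 2 ^ i * (\<Sum>e\<in>{e\<in>U. f e \<noteq> 0}. w i e))"
      unfolding wsum_def v_def by (subst sum.swap) (simp add: sum_distrib_left)
    also have "\<dots> = (\<Sum>i<N. 2 ^ i * wsum (w i) (E i) f)"
      unfolding wsum_def using U(1) w0
      by (intro sum.cong refl arg_cong2[where f = "(*)"] sum.mono_neutral_right) (auto simp: E_def)
    finally show ?thesis .
  qed
  show ?thesis
  proof (intro exI[of _ v] conjI allI ballI)
    show "0 \<le> v e" for e unfolding v_def using w(1) by (intro sum_nonneg) auto
  next
    have "{e \<in> U. v e \<noteq> 0} \<subseteq> (\<Union>i<N. {e \<in> E i. w i e \<noteq> 0})"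
    proof
      fix e assume "e \<in> {e \<in> U. v e \<noteq> 0}"
      then have "\<exists>i<N. w i e \<noteq> 0"
        by (rule contrapos_pp) (simp add: v_def)
      then obtain i where "i < N" "w i e \<noteq> 0" by blast
      then show "e \<in> (\<Union>i<N. {e \<in> E i. w i e \<noteq> 0})" using w0 by auto
    qed
    then have "card {e \<in> U. v e \<noteq> 0} \<le> card (\<Union>i<N. {e \<in> E i. w i e \<noteq> 0})"
      using fin by (intro card_mono) auto
    also have "\<dots> \<le> (\<Sum>i<N. card {e \<in> E i. w i e \<noteq> 0})" by (rule card_UN_le) simp
    finally have "real (card {e \<in> U. v e \<noteq> 0}) \<le> (\<Sum>i<N. real (card {e \<in> E i. w i e \<noteq> 0}))"
      by (simp flip: of_nat_sum)
    also have "\<dots> \<le> (\<Sum>i<N. t * (d * (q (i + L) - q i)))"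
    proof (rule sum_mono)
      fix i assume "i \<in> {..<N}"
      then have "t * (d * log 2 (card (?D i))) \<le> t * (d * (q (i + L) - q i))"
        using rank d by (intro mult_left_mono) auto
      then show "real (card {e \<in> E i. w i e \<noteq> 0}) \<le> t * (d * (q (i + L) - q i))"
        using cardw[of i] by linarith
    qed
    also have "\<dots> = t * d * (\<Sum>i<N. q (i + L) - q i)"
      by (simp add: sum_distrib_left mult.assoc)
    also have "\<dots> \<le> t * d * (L * log 2 (card C))"
      using q d by (intro mult_left_mono sum_shift_diff_le) auto
    finally show "card {e \<in> U. v e \<noteq> 0} \<le> t * d * L * log 2 (card C)"
      by (simp add: mult.assoc)
  next
    fix f assume f: "f \<in> C"
    let ?W = "wsum u U f"
    have wt0: "wt (E i) f = 0 \<longleftrightarrow> (\<forall>e\<in>E i. f e = 0)" for i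
      unfolding wt_def using fin by auto
    show "\<bar>wsum v U f - ?W\<bar> \<le> \<delta> * ?W"
    proof (cases "\<exists>i<N. wt (E i) f \<noteq> 0")
      case False
      have "wsum (w i) (E i) f = 0" if "i < N" for i
        unfolding wsum_def using False that wt0[of i] by (intro sum.neutral) auto
      then show ?thesis using False by (simp add: u_eq v_eq)
    next
      case True
      define I where "I = Max {i. i < N \<and> wt (E i) f \<noteq> 0}"
      have I: "I \<in> {i. i < N \<and> wt (E i) f \<noteq> 0}"
        unfolding I_def using True by (intro Max_in) auto
      have above: "wt (E i) f = 0" if "I < i" "i < N" for i
      proof (rule ccontr)
        assume "wt (E i) f \<noteq> 0"
        then have "i \<le> I" unfolding I_def using that by (intro Max_ge) auto
        then show False using that by simp
      qed
      have "1 \<le> wt (E I) f" using I by simp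
      then have "2 ^ I * 1 \<le> 2 ^ I * real (wt (E I) f)" by (intro mult_left_mono) auto
      also have "\<dots> \<le> ?W" unfolding u_eq using I by (intro member_le_sum) auto
      finally have W: "2 ^ I \<le> ?W" by simp
      have low: "\<bar>wsum (w i) (E i) f - wt (E i) f\<bar> \<le> 4 ^ t" for i
      proof -
        have "wsum (w i) (E i) f \<le> (\<Sum>e\<in>{e \<in> E i. f e \<noteq> 0}. 2 ^ t)"
          unfolding wsum_def using w(2) by (rule sum_mono)
        also have "\<dots> = real (wt (E i) f) * 2 ^ t" by (simp add: wt_def)
        finally have 1: "wsum (w i) (E i) f \<le> real (wt (E i) f) * 2 ^ t" .
        have "wt (E i) f \<le> card U"
          unfolding wt_def using U(1) by (intro card_mono) (auto simp: E_def)
        then have "wt (E i) f \<le> 2 ^ t" using U(2) by linarith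
        then have 2: "real (wt (E i) f) \<le> 2 ^ t" by (simp add: of_nat_le_iff[symmetric] del: of_nat_le_iff)
        then have "real (wt (E i) f) * 2 ^ t \<le> 2 ^ t * 2 ^ t" by (intro mult_right_mono) auto
        then have 3: "real (wt (E i) f) * 2 ^ t \<le> 4 ^ t" by (simp flip: power_mult_distrib)
        have 4: "(2::real) ^ t \<le> 4 ^ t" by (intro power_mono) auto
        have "0 \<le> wsum (w i) (E i) f" unfolding wsum_def using w(1) by (intro sum_nonneg) auto
        then show ?thesis using 1 2 3 4 by linarith
      qed
      \<comment> \<open>Within \<open>L\<close> digits of the top digit \<open>I\<close>,
        \<open>f\<close> lies in \<open>Q (i + L)\<close> and the sparsifier of digit
        \<open>i\<close> is accurate on it. Further below, only the crude bound \<open>low\<close>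
        is available.\<close>
      have dig: "2 ^ i * \<bar>wsum (w i) (E i) f - wt (E i) f\<bar>
          \<le> \<delta> / 2 * (2 ^ i * real (wt (E i) f)) + (if i + L \<le> I then 2 ^ i * 4 ^ t else 0)" if "i < N" for i
      proof (cases "i + L \<le> I")
        case True
        have "1 \<le> (1 + \<epsilon>) ^ t" using \<epsilon> by (intro one_le_power) auto
        then have "0 \<le> \<delta> / 2 * (2 ^ i * real (wt (E i) f))" using \<delta> by simp
        moreover have "2 ^ i * \<bar>wsum (w i) (E i) f - wt (E i) f\<bar> \<le> 2 ^ i * 4 ^ t"
          using low by (intro mult_left_mono) auto
        ultimately show ?thesis unfolding if_P[OF True] by linarith
      next
        case False
        then have "f e = 0" if "j \<in> {i + L..<N}" "e \<in> E j" for j e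
          using that above[of j] wt0[of j] by auto
        then have "f \<in> Q (i + L)" unfolding Q_def using f by blast
        then have "restr (E i) f \<in> ?D i" by blast
        from errw[OF this] have "\<bar>wsum (w i) (E i) f - wt (E i) f\<bar> \<le> ((1 + \<epsilon>) ^ t - 1) * wt (E i) f"
          by (simp add: wsum_restr wt_restr)
        also have "\<dots> \<le> \<delta> / 2 * wt (E i) f"
          using \<delta> by (intro mult_right_mono) auto
        finally have "2 ^ i * \<bar>wsum (w i) (E i) f - wt (E i) f\<bar> \<le> 2 ^ i * (\<delta> / 2 * wt (E i) f)"
          by (intro mult_left_mono) auto
        then show ?thesis using False by (simp add: algebra_simps)
      qed
      have geo: "2 ^ L * (\<Sum>i<n. if i + L \<le> I then 2 ^ i else 0) \<le> 2 * (2::real) ^ I" for n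
      proof -
        have "(\<Sum>i<n. if i + L \<le> I then 2 ^ i else 0) = (\<Sum>i\<in>{i \<in> {..<n}. i + L \<le> I}. (2::real) ^ i)"
          by (rule sum.inter_filter[symmetric]) simp
        also have "\<dots> \<le> (\<Sum>i<Suc I - L. 2 ^ i)"
          by (rule sum_mono2) auto
        also have "\<dots> = 2 ^ (Suc I - L) - 1"
          by (simp add: geometric_sum)
        finally have "(\<Sum>i<n. if i + L \<le> I then 2 ^ i else 0) \<le> (2::real) ^ (Suc I - L) - 1" .
        then have "2 ^ L * (\<Sum>i<n. if i + L \<le> I then 2 ^ i else 0) \<le> 2 ^ L * ((2::real) ^ (Suc I - L) - 1)"
          by (intro mult_left_mono) auto
        also have "\<dots> \<le> 2 ^ Suc I"
        proof (cases "L \<le> Suc I")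
          case True
          then show ?thesis by (simp add: right_diff_distrib flip: power_add)
        qed simp
        finally show ?thesis by simp
      qed
      have "\<bar>wsum v U f - ?W\<bar> = \<bar>\<Sum>i<N. 2 ^ i * (wsum (w i) (E i) f - wt (E i) f)\<bar>"
        by (simp add: u_eq v_eq right_diff_distrib sum_subtractf)
      also have "\<dots> \<le> (\<Sum>i<N. \<bar>2 ^ i * (wsum (w i) (E i) f - wt (E i) f)\<bar>)"
        by (rule sum_abs)
      also have "\<dots> \<le> (\<Sum>i<N. \<delta> / 2 * (2 ^ i * real (wt (E i) f)) + (if i + L \<le> I then 2 ^ i else 0) * 4 ^ t)"
      proof (rule sum_mono)
        fix i assume "i \<in> {..<N}"
        then have "2 ^ i * \<bar>wsum (w i) (E i) f - wt (E i) f\<bar>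
            \<le> \<delta> / 2 * (2 ^ i * real (wt (E i) f)) + (if i + L \<le> I then 2 ^ i * 4 ^ t else 0)"
          by (intro dig) simp
        also have "(if i + L \<le> I then 2 ^ i * 4 ^ t else 0) = (if i + L \<le> I then 2 ^ i else 0) * (4::real) ^ t"
          by simp
        finally show "\<bar>2 ^ i * (wsum (w i) (E i) f - wt (E i) f)\<bar>
            \<le> \<delta> / 2 * (2 ^ i * real (wt (E i) f)) + (if i + L \<le> I then 2 ^ i else 0) * 4 ^ t"
          unfolding abs_mult by simp
      qed
      also have "\<dots> = \<delta> / 2 * ?W + (\<Sum>i<N. if i + L \<le> I then 2 ^ i else 0) * 4 ^ t"
        unfolding u_eq sum.distrib sum_distrib_left sum_distrib_right ..
      \<comment> \<open>The far digits contribute at most 4^t 2^(I + 1) / 2^L, which the hypothesis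
        on \<open>L\<close> turns into \<delta>/2 times 2^I.\<close>
      also have "(\<Sum>i<N. if i + L \<le> I then 2 ^ i else 0) * 4 ^ t \<le> \<delta> / 2 * ?W"
      proof -
        let ?G = "\<Sum>i<N. if i + L \<le> I then (2::real) ^ i else 0"
        have G: "0 \<le> ?G" by (intro sum_nonneg) auto
        have "0 \<le> \<delta>" using L by (smt (verit) zero_less_power mult_nonneg_nonneg mult_neg_pos)
        have "4 * (?G * 4 ^ t) = ?G * (4 * 4 ^ t)" by simp
        also have "\<dots> \<le> ?G * (\<delta> * 2 ^ L)" using L G by (intro mult_left_mono)
        also have "\<dots> = \<delta> * (2 ^ L * ?G)" by simp
        also have "\<dots> \<le> \<delta> * (2 * 2 ^ I)" using \<open>0 \<le> \<delta>\<close> geo by (intro mult_left_mono)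
        also have "\<dots> \<le> \<delta> * (2 * ?W)" using \<open>0 \<le> \<delta>\<close> W by (intro mult_left_mono) auto
        finally show ?thesis by (simp add: mult_ac)
      qed
      finally show ?thesis by simp
    qed
  qed
qed

subsection \<open>Predicates as supports of affine forms\<close>

text \<open>Integers and divisibility, rather than the type \<open>4\<close>, let the case analysis
  over the cube be evaluated on numerals.\<close>

definition form4 :: "int \<Rightarrow> int \<Rightarrow> int \<Rightarrow> int \<Rightarrow> bool \<Rightarrow> bool \<Rightarrow> bool \<Rightarrow> bool" where
  "form4 a b c d x y z \<longleftrightarrow> \<not> 4 dvd (a * of_bool x + b * of_bool y + c * of_bool z + d)"

text \<open>The 48 instances of the hypothesis are the four orientations of AND on the six faces and the six
  diagonal planes of the cube; only 19 of the predicates vanishing at the origin survive them.\<close>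

lemma affine_mod4_at_zero:
  assumes no: "\<And>p q r. \<not> (\<forall>x y. P (lit_val p x y) (lit_val q x y) (lit_val r x y) = (x \<and> y))"
    and "\<not> P False False False"
  shows "\<exists>a\<in>{0,1,2,3}. \<exists>b\<in>{0,1,2,3}. \<exists>c\<in>{0,1,2,3}. \<forall>x y z. P x y z = form4 a b c 0 x y z"
  using assms(2)  no[of Zero X Y] no[of Zero X NotY] no[of Zero NotX Y] no[of Zero NotX NotY]
    no[of One X Y] no[of One X NotY] no[of One NotX Y] no[of One NotX NotY]
    no[of X Zero Y] no[of X Zero NotY] no[of NotX Zero Y] no[of NotX Zero NotY]
    no[of X One Y] no[of X One NotY] no[of NotX One Y] no[of NotX One NotY]
    no[of X Y Zero] no[of X NotY Zero] no[of NotX Y Zero] no[of NotX NotY Zero]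
    no[of X Y One] no[of X NotY One] no[of NotX Y One] no[of NotX NotY One]
    no[of X X Y] no[of X X NotY] no[of NotX NotX Y] no[of NotX NotX NotY]
    no[of X NotX Y] no[of X NotX NotY] no[of NotX X Y] no[of NotX X NotY]
    no[of X Y X] no[of X NotY X] no[of NotX Y NotX] no[of NotX NotY NotX]
    no[of X Y NotX] no[of X NotY NotX] no[of NotX Y X] no[of NotX NotY X]
    no[of Y X X] no[of NotY X X] no[of Y NotX NotX] no[of NotY NotX NotX]
    no[of Y X NotX] no[of NotY X NotX] no[of Y NotX X] no[of NotY NotX X]
  unfolding all_bool_eq lit_val.simps
  apply (simp add: form4_def del: not_all)
  by (cases "P True True True"; cases "P True True False"; cases "P True False True";
      cases "P True False False"; cases "P False True True"; cases "P False True False";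
      cases "P False False True"; simp)

fun neg_lit :: "lit \<Rightarrow> lit" where
  "neg_lit Zero = One"
| "neg_lit One = Zero"
| "neg_lit X = NotX"
| "neg_lit NotX = X"
| "neg_lit Y = NotY"
| "neg_lit NotY = Y"

lemma lit_val_neg_lit: "lit_val (neg_lit l) x y \<longleftrightarrow> \<not> lit_val l x y"
  by (cases l) auto

text \<open>Flipping coordinates moves a zero of \<open>P\<close> to the origin. Literals are closed
  under negation, so no projection appears, and negating a variable keeps a form affine. A predicate
  without zeros is a nonzero constant form.\<close>

lemma affine_if_no_projection:
  assumes "\<not> has_affine_projection_to_AND P"
  shows "\<exists>a b c d :: 4. \<forall>x y z. P x y z \<longleftrightarrow> a * of_bool x + b * of_bool y + c * of_bool z + d \<noteq> 0"
proof -
  have no: "\<not> (\<forall>x y. P (lit_val p x y) (lit_val q x y) (lit_val r x y) = (x \<and> y))" for p q r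
  proof
    assume "\<forall>x y. P (lit_val p x y) (lit_val q x y) (lit_val r x y) = (x \<and> y)"
    then have "has_affine_projection_to_AND P"
      unfolding has_affine_projection_to_AND_def
      by (intro exI[of _ "\<lambda>n. if n = 1 then p else if n = 2 then q else r"]) simp
    then show False using assms by blast
  qed
  have "\<exists>a b c d :: int. \<forall>x y z. P x y z = form4 a b c d x y z"
  proof (cases "\<forall>x y z. P x y z")
    case True
    then show ?thesis by (intro exI[of _ 0] exI[of _ 1]) (simp add: form4_def)
  next
    case False
    then obtain x0 y0 z0 where "\<not> P x0 y0 z0" by blast
    define R where "R = (\<lambda>x y z. P (x \<noteq> x0) (y \<noteq> y0) (z \<noteq> z0))"
    have "\<not> (\<forall>x y. R (lit_val p x y) (lit_val q x y) (lit_val r x y) = (x \<and> y))" for p q r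
      using no[of "if x0 then neg_lit p else p" "if y0 then neg_lit q else q" "if z0 then neg_lit r else r"]
      unfolding R_def by (cases x0; cases y0; cases z0) (simp_all add: lit_val_neg_lit)
    moreover have "\<not> R False False False" using \<open>\<not> P x0 y0 z0\<close> by (simp add: R_def)
    ultimately obtain a b c where R: "\<And>x y z. R x y z = form4 a b c 0 x y z"
      using affine_mod4_at_zero[of R] by blast
    have "P x y z = form4 (if x0 then - a else a) (if y0 then - b else b) (if z0 then - c else c)
        ((if x0 then a else 0) + (if y0 then b else 0) + (if z0 then c else 0)) x y z" for x y z
    proof -
      have "P x y z = R (x \<noteq> x0) (y \<noteq> y0) (z \<noteq> z0)"
        unfolding R_def by (rule arg_cong3[where f = P]) auto
      also have "\<dots> = form4 a b c 0 (x \<noteq> x0) (y \<noteq> y0) (z \<noteq> z0)" by (rule R)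
      also have "\<dots> = form4 (if x0 then - a else a) (if y0 then - b else b) (if z0 then - c else c)
        ((if x0 then a else 0) + (if y0 then b else 0) + (if z0 then c else 0)) x y z"
        unfolding form4_def by (rule arg_cong[where f = "\<lambda>s. \<not> 4 dvd s"]) (auto simp: of_bool_def)
      finally show ?thesis .
    qed
    then show ?thesis by blast
  qed
  then obtain a b c d :: int where form: "\<And>x y z. P x y z = form4 a b c d x y z" by blast
  have "P x y z \<longleftrightarrow> of_int a * of_bool x + of_int b * of_bool y + of_int c * of_bool z + of_int d \<noteq> (0::4)" for x y z
  proof -
    have "of_int a * of_bool x + of_int b * of_bool y + of_int c * of_bool z + of_int d
        = (of_int (a * of_bool x + b * of_bool y + c * of_bool z + d) :: 4)"
      by simp
    then show ?thesis
      unfolding form form4_def by (simp only: of_int_eq_0_iff_char_dvd bit0.CHAR_eq) simp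
  qed
  then show ?thesis by blast
qed

subsection \<open>From codes to constraints\<close>

text \<open>The coordinate \<open>y k\<close> homogenises the affine form, so that the words are closed under subtraction.\<close>

definition word :: "4 \<times> 4 \<times> 4 \<times> 4 \<Rightarrow> nat \<Rightarrow> (nat \<Rightarrow> 4) \<Rightarrow> nat \<times> nat \<times> nat \<Rightarrow> 4" where
  "word = (\<lambda>(a, b, c, d) k y (i, j, l).
     if i < k \<and> j < k \<and> l < k then a * y i + b * y j + c * y l + d * y k else 0)"

definition words :: "4 \<times> 4 \<times> 4 \<times> 4 \<Rightarrow> nat \<Rightarrow> (nat \<times> nat \<times> nat \<Rightarrow> 4) set" where
  "words p k = word p k ` ({..k} \<rightarrow>\<^sub>E UNIV)"

lemma is_code_words: "is_code (words p k)"
  unfolding is_code_def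
proof (intro conjI ballI)
  show "finite (words p k)" unfolding words_def by (intro finite_imageI finite_PiE) auto
  have "(\<lambda>_. 0) = word p k (restrict (\<lambda>_. 0) {..k})"
    by (auto simp: word_def fun_eq_iff split: prod.splits)
  also have "\<dots> \<in> words p k" unfolding words_def by (rule imageI, subst restrict_PiE_iff) simp
  finally show "(\<lambda>_. 0) \<in> words p k" .
next
  fix f g assume "f \<in> words p k" "g \<in> words p k"
  then obtain y z where "f = word p k y" "g = word p k z" unfolding words_def by blast
  then have "(\<lambda>e. f e - g e) = word p k (restrict (\<lambda>i. y i - z i) {..k})"
    by (auto simp: word_def fun_eq_iff algebra_simps split: prod.splits)
  also have "\<dots> \<in> words p k" unfolding words_def by (rule imageI, subst restrict_PiE_iff) simp
  finally show "(\<lambda>e. f e - g e) \<in> words p k" .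
qed

lemma card_words_le: "card (words p k) \<le> 4 ^ (k + 1)"
proof -
  have "card (words p k) \<le> card ({..k} \<rightarrow>\<^sub>E (UNIV :: 4 set))"
    unfolding words_def by (intro card_image_le finite_PiE) auto
  also have "\<dots> = 4 ^ (k + 1)" by (simp add: card_PiE)
  finally show ?thesis .
qed

lemma log_card_words_le:
  assumes "1 \<le> k"
  shows "log 2 (card (words p k)) \<le> 4 * real k"
proof -
  have "card (words p k) \<le> 4 ^ (k + 1)" by (rule card_words_le)
  also have "(4::nat) ^ (k + 1) = 2 ^ (2 * (k + 1))" by (simp only: power_mult) simp
  finally have "log 2 (card (words p k)) \<le> real (2 * (k + 1))"
    using card_code_pos[OF is_code_words] by (rule log2_of_power_le)
  then show ?thesis using assms by simp
qed

text \<open>The code merges repeated constraints into one coordinate whose multiplicity is its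
  weight; a kept triple is realised by a single occurrence \<open>pos\<close>.\<close>

lemma sparsifier_of_weights:
  fixes w :: "nat \<times> nat \<times> nat \<Rightarrow> real"
  assumes P: "\<And>x y z. P x y z \<longleftrightarrow> a * of_bool x + b * of_bool y + c * of_bool z + d \<noteq> (0::4)"
    and inst: "is_instance k cs" and w: "\<And>e. 0 \<le> w e"
    and err: "\<And>f. f \<in> words (a, b, c, d) k \<Longrightarrow>
      \<bar>wsum w (set cs) f - wsum (\<lambda>e. card {j. j < length cs \<and> cs ! j = e}) (set cs) f\<bar>
      \<le> \<epsilon> * wsum (\<lambda>e. card {j. j < length cs \<and> cs ! j = e}) (set cs) f"
  shows "\<exists>T v. is_sparsifier P k cs \<epsilon> T v \<and> card T \<le> card {e \<in> set cs. w e \<noteq> 0}"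
proof -
  let ?u = "\<lambda>e. real (card {j. j < length cs \<and> cs ! j = e})"
  define pos where "pos = (\<lambda>e. SOME j. j < length cs \<and> cs ! j = e)"
  have pos: "pos e < length cs \<and> cs ! pos e = e" if "e \<in> set cs" for e
    unfolding pos_def by (rule someI_ex) (use that in \<open>simp add: in_set_conv_nth\<close>)
  define S where "S = {e \<in> set cs. w e \<noteq> 0}"
  define T where "T = pos ` S"
  have "inj_on pos S"
    by (rule inj_on_inverseI[where g = "\<lambda>j. cs ! j"]) (use pos in \<open>auto simp: S_def\<close>)
  have "card T \<le> card S" unfolding T_def S_def by (intro card_image_le) auto
  moreover have "is_sparsifier P k cs \<epsilon> T (\<lambda>j. w (cs ! j))"
    unfolding is_sparsifier_def
  proof (intro conjI allI impI ballI)
    show "T \<subseteq> {..<length cs}" using pos by (auto simp: T_def S_def)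
    show "0 \<le> w (cs ! j)" for j by (rule w)
  next
    fix x :: "nat \<Rightarrow> bool"
    \<comment> \<open>Setting the homogenising coordinate to 1 restores the constant term, so
      nonzero entries are satisfied constraints.\<close>
    define f where "f = word (a, b, c, d) k (restrict (\<lambda>i. if i < k then of_bool (x i) else 1) {..k})"
    have "f \<in> words (a, b, c, d) k" unfolding f_def words_def by (rule imageI, subst restrict_PiE_iff) simp
    have val: "constr_val P e x = (if f e \<noteq> 0 then 1 else 0)" if "e \<in> set cs" for e
      using inst that
      by (auto simp: is_instance_def constr_val_def f_def word_def P split: prod.splits)
    have full: "(\<Sum>j<length cs. constr_val P (cs ! j) x) = wsum ?u (set cs) f"
    proof -
      have "(\<Sum>j<length cs. constr_val P (cs ! j) x)
          = (\<Sum>e\<in>set cs. \<Sum>j\<in>{j \<in> {..<length cs}. cs ! j = e}. constr_val P (cs ! j) x)"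
        by (rule sum.group[symmetric]) auto
      also have "\<dots> = (\<Sum>e\<in>set cs. if f e \<noteq> 0 then ?u e else 0)"
        by (intro sum.cong refl) (simp add: val)
      also have "\<dots> = wsum ?u (set cs) f"
        unfolding wsum_def by (rule sum.inter_filter[symmetric]) simp
      finally show ?thesis .
    qed
    have part: "(\<Sum>j\<in>T. w (cs ! j) * constr_val P (cs ! j) x) = wsum w (set cs) f"
    proof -
      have "(\<Sum>j\<in>T. w (cs ! j) * constr_val P (cs ! j) x) = (\<Sum>e\<in>S. w e * constr_val P e x)"
        unfolding T_def using pos by (subst sum.reindex[OF \<open>inj_on pos S\<close>]) (auto simp: S_def)
      also have "\<dots> = (\<Sum>e\<in>set cs. w e * constr_val P e x)"
        by (rule sum.mono_neutral_left) (auto simp: S_def)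
      also have "\<dots> = (\<Sum>e\<in>set cs. if f e \<noteq> 0 then w e else 0)"
        by (intro sum.cong refl) (simp add: val)
      also have "\<dots> = wsum w (set cs) f"
        unfolding wsum_def by (rule sum.inter_filter[symmetric]) simp
      finally show ?thesis .
    qed
    show "(1 - \<epsilon>) * (\<Sum>j<length cs. constr_val P (cs ! j) x) \<le> (\<Sum>j\<in>T. w (cs ! j) * constr_val P (cs ! j) x)"
      "(\<Sum>j\<in>T. w (cs ! j) * constr_val P (cs ! j) x) \<le> (1 + \<epsilon>) * (\<Sum>j<length cs. constr_val P (cs ! j) x)"
      using err[OF \<open>f \<in> words (a, b, c, d) k\<close>] unfolding full part
      by (simp_all add: algebra_simps abs_le_iff)
  qed
  ultimately show ?thesis unfolding S_def by blast
qed

section \<open>Choice of parameters\<close>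

lemma one_plus_div_power_le:
  fixes \<epsilon> :: real
  assumes "0 < \<epsilon>" "\<epsilon> \<le> 1" "0 < t"
  shows "(1 + \<epsilon> / (4 * real t)) ^ t - 1 \<le> \<epsilon> / 2"
proof -
  have "(1 + \<epsilon> / (4 * real t)) ^ t \<le> exp (\<epsilon> / (4 * real t)) ^ t"
    using assms by (intro power_mono exp_ge_add_one_self) auto
  also have "\<dots> = exp (\<epsilon> / 4)"
    using assms by (simp add: exp_of_nat_mult[symmetric])
  also have "\<dots> \<le> 1 + \<epsilon> / 4 + (\<epsilon> / 4)\<^sup>2"
    using assms by (intro exp_bound) auto
  also have "(\<epsilon> / 4)\<^sup>2 \<le> \<epsilon> / 4"
    using assms power_le_one[of "\<epsilon> / 4" 1] by (simp add: power2_eq_square mult_le_one)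
  finally show ?thesis by simp
qed

text \<open>The count \<open>t * D * L * rank\<close> is bounded with \<open>t\<close> at most 3l,
  \<open>D\<close> at most 64 (3l)^2 (5l) / \<epsilon>^2, \<open>L\<close> at most 7l and rank at
  most 4k; 3 * 64 * 9 * 5 * 7 * 4 = 241920.\<close>

lemma sparsifier_of_affine:
  assumes P: "\<And>x y z. P x y z \<longleftrightarrow> a * of_bool x + b * of_bool y + c * of_bool z + d \<noteq> (0::4)"
    and \<epsilon>: "0 < \<epsilon>" "\<epsilon> < 1" and inst: "is_instance k cs" and k: "1 \<le> k"
  defines "l \<equiv> log 2 (4 * real k / \<epsilon>)"
  shows "\<exists>T w. is_sparsifier P k cs \<epsilon> T w \<and> card T \<le> 241920 * (real k / \<epsilon>\<^sup>2) * l ^ 5"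
proof -
  define lk le where "lk = log 2 (real k)" and "le = log 2 (1 / \<epsilon>)"
  have lk: "0 \<le> lk" and le: "0 \<le> le" unfolding lk_def le_def using k \<epsilon> by auto
  have "l = log 2 (2 ^ 2 * (real k * (1 / \<epsilon>)))" by (simp add: l_def)
  also have "\<dots> = log 2 (2 ^ 2) + log 2 (real k * (1 / \<epsilon>))"
    using k \<epsilon> by (intro log_mult_pos) auto
  also have "log 2 (real k * (1 / \<epsilon>)) = lk + le"
    unfolding lk_def le_def using k \<epsilon> by (intro log_mult_pos) auto
  also have "log 2 (2 ^ 2) = real 2" by (rule log_pow_cancel) auto
  finally have l: "l = 2 + lk + le" by simp
  \<comment> \<open>Least such that \<open>2 ^ t\<close> exceeds \<open>k ^ 3\<close>, a bound on
    the number of distinct triples.\<close>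
  define t where "t = nat \<lfloor>3 * lk\<rfloor> + 1"
  have t: "3 * lk < t" "real t \<le> 3 * lk + 1" "0 < t"
    unfolding t_def using lk by linarith+
  define L where "L = 2 * t + 2 + nat \<lceil>le\<rceil>"
  have nle: "le \<le> nat \<lceil>le\<rceil>" "nat \<lceil>le\<rceil> \<le> le + 1" using le by linarith+
  define r where "r = 2 * k + 2"
  \<comment> \<open>An error of \<epsilon> / (4t) per halving compounds to at most \<epsilon> / 2;
    \<open>D\<close> then makes the exponential in the union bound equal to 1 / m.\<close>
  define \<eta> where "\<eta> = \<epsilon> / (4 * real t)"
  define m where "m = 32 * (real r)\<^sup>2"
  define D where "D = 4 * ln m / \<eta>\<^sup>2"
  have \<eta>: "0 < \<eta>" "\<eta> \<le> 1"
    using \<epsilon> t(3) unfolding \<eta>_def by (auto simp: field_simps)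
  have r32: "1 < m"
  proof -
    have "1\<^sup>2 \<le> (real r)\<^sup>2" unfolding r_def by (intro power_mono) auto
    then show ?thesis by (simp add: m_def)
  qed
  have D: "0 < D" unfolding D_def using \<eta> r32 by simp
  have ex: "exp (- (\<eta>\<^sup>2 / 4 * D)) \<le> 1 / m"
  proof -
    have "\<eta>\<^sup>2 / 4 * D = ln m" unfolding D_def using \<eta> by simp
    then show ?thesis using r32 by (simp add: exp_minus inverse_eq_divide)
  qed
  have "card (set cs) \<le> card ({..<k} \<times> {..<k} \<times> {..<k})"
    using inst by (intro card_mono) (auto simp: is_instance_def)
  also have "\<dots> = k ^ 3" by (simp add: card_cartesian_product power3_eq_cube)
  also have "k ^ 3 < 2 ^ t"
  proof -
    have "2 powr lk = real k" unfolding lk_def using k by simp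
    then have "real k ^ 3 = 2 powr (lk + lk + lk)"
      by (simp only: powr_add power3_eq_cube)
    also have "\<dots> < 2 powr (real t)" using t(1) by simp
    also have "\<dots> = 2 ^ t" by (simp add: powr_realpow)
    finally show ?thesis by (metis of_nat_less_iff of_nat_numeral of_nat_power)
  qed
  finally have card: "card (set cs) < 2 ^ t" .
  have "card (words (a, b, c, d) k) \<le> 4 ^ (k + 1)" by (rule card_words_le)
  also have "(4::nat) ^ (k + 1) = 2 ^ (2 * (k + 1))" by (simp only: power_mult) simp
  also have "\<dots> < 2 ^ (r + 1)" unfolding r_def by (intro power_strict_increasing) auto
  finally have rC: "card (words (a, b, c, d) k) < 2 ^ (r + 1)" .
  have L: "4 * 4 ^ t \<le> \<epsilon> * 2 ^ L"
  proof -
    have "1 / \<epsilon> = 2 powr le" unfolding le_def using \<epsilon> by simp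
    also have "\<dots> \<le> 2 powr (real (nat \<lceil>le\<rceil>))" using nle by simp
    also have "\<dots> = 2 ^ nat \<lceil>le\<rceil>" by (simp add: powr_realpow)
    finally have "1 \<le> \<epsilon> * 2 ^ nat \<lceil>le\<rceil>" using \<epsilon> by (simp add: field_simps)
    then have "4 * 4 ^ t * 1 \<le> 4 * 4 ^ t * (\<epsilon> * 2 ^ nat \<lceil>le\<rceil>)" by (intro mult_left_mono) auto
    also have "\<dots> = \<epsilon> * 2 ^ L" by (simp add: L_def power_add power_mult)
    finally show ?thesis by simp
  qed
  have r1: "1 \<le> r" by (simp add: r_def)
  have half: "(1 + \<eta>) ^ t - 1 \<le> \<epsilon> / 2"
    unfolding \<eta>_def using one_plus_div_power_le \<epsilon> t(3) by simp
  obtain w where w: "\<And>e. 0 \<le> w e"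
    and cardw: "card {e\<in>set cs. w e \<noteq> 0} \<le> t * D * L * log 2 (card (words (a, b, c, d) k))"
    and err: "\<And>f. f \<in> words (a, b, c, d) k \<Longrightarrow>
      \<bar>wsum w (set cs) f - wsum (\<lambda>e. card {j. j < length cs \<and> cs ! j = e}) (set cs) f\<bar>
      \<le> \<epsilon> * wsum (\<lambda>e. card {j. j < length cs \<and> cs ! j = e}) (set cs) f"
    using exists_sparsifier_weighted[OF is_code_words finite_set card D rC r1 \<eta> ex[unfolded m_def] half L,
        of "\<lambda>e. card {j. j < length cs \<and> cs ! j = e}"]
    by blast
  obtain T v where T: "is_sparsifier P k cs \<epsilon> T v" "card T \<le> card {e \<in> set cs. w e \<noteq> 0}"
    using sparsifier_of_weights[OF P inst w err] by blast
  have l_ge: "2 \<le> l" using l lk le by simp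
  have tl: "real t \<le> 3 * l" using t(2) l lk le by linarith
  have "real L = 2 * real t + 2 + real (nat \<lceil>le\<rceil>)" unfolding L_def by simp
  then have Ll: "real L \<le> 7 * l" using t(2) nle(2) l lk le by linarith
  have lnl: "ln m \<le> 5 * l"
  proof -
    have "real r \<le> 4 * real k" using k by (simp add: r_def)
    then have "(real r)\<^sup>2 \<le> (4 * real k)\<^sup>2" by (intro power_mono) auto
    then have "m \<le> 2 ^ 9 * real k ^ 2" by (simp add: m_def power_mult_distrib)
    then have "log 2 m \<le> log 2 (2 ^ 9 * real k ^ 2)"
      using r32 k by (intro log_mono) auto
    also have "\<dots> = log 2 (2 ^ 9) + log 2 (real k ^ 2)"
      using k by (intro log_mult_pos) auto
    also have "\<dots> = 9 + 2 * lk"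
      unfolding lk_def using k log_nat_power[of "real k" 2 2] log_pow_cancel[of "2::real" 9] by simp
    also have "\<dots> \<le> 5 * l" using l lk le by simp
    finally have "log 2 m \<le> 5 * l" .
    moreover have "ln m \<le> log 2 m"
    proof -
      have "ln (2::real) \<le> 1" using ln_le_minus_one[of "2::real"] by simp
      then have "ln m * ln 2 \<le> ln m * 1"
        using r32 by (intro mult_left_mono) auto
      then show ?thesis by (simp add: log_def field_simps)
    qed
    ultimately show ?thesis by linarith
  qed
  have "D = 64 * (real t)\<^sup>2 * ln m / \<epsilon>\<^sup>2"
    unfolding D_def \<eta>_def by (simp add: power_divide power_mult_distrib)
  also have "\<dots> \<le> 64 * (3 * l)\<^sup>2 * (5 * l) / \<epsilon>\<^sup>2"
    using tl lnl r32 l_ge by (intro divide_right_mono mult_mono power_mono) auto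
  finally have Dl: "D \<le> 64 * (3 * l)\<^sup>2 * (5 * l) / \<epsilon>\<^sup>2" .
  have "t * D * L * log 2 (card (words (a, b, c, d) k))
      \<le> (3 * l) * (64 * (3 * l)\<^sup>2 * (5 * l) / \<epsilon>\<^sup>2) * (7 * l) * (4 * real k)"
    using tl Dl Ll log_card_words_le[OF k] l_ge D card_code_pos[OF is_code_words]
    by (intro mult_mono) (auto simp: Suc_le_eq)
  also have "\<dots> = 241920 * (real k / \<epsilon>\<^sup>2) * l ^ 5"
    by (simp add: power_mult_distrib power2_eq_square eval_nat_numeral)
  finally have "real (card T) \<le> 241920 * (real k / \<epsilon>\<^sup>2) * l ^ 5"
    using T(2) cardw by linarith
  then show ?thesis using T(1) by blast
qed

lemma exists_sparsifier:
  assumes P: "\<And>x y z. P x y z \<longleftrightarrow> a * of_bool x + b * of_bool y + c * of_bool z + d \<noteq> (0::4)"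
    and \<epsilon>: "0 < \<epsilon>" "\<epsilon> < 1" and inst: "is_instance k cs"
  shows "\<exists>T w. is_sparsifier P k cs \<epsilon> T w \<and>
    real (card T) \<le> 241920 * (real k / \<epsilon>\<^sup>2) * (log 2 (4 * real k / \<epsilon>)) powr 5"
proof (cases "k = 0")
  \<comment> \<open>On no variables the instance is empty and the bound is 0.\<close>
  case True
  with inst have "cs = []" by (cases cs) (auto simp: is_instance_def)
  then show ?thesis using True
    by (intro exI[of _ "{}"]) (simp add: is_sparsifier_def)
next
  case False
  then have "1 \<le> 4 * real k" by simp
  then have "1 < 4 * real k / \<epsilon>" using \<epsilon> by (simp add: field_simps)
  then have "0 < log 2 (4 * real k / \<epsilon>)" by simp
  then have "(log 2 (4 * real k / \<epsilon>)) powr 5 = (log 2 (4 * real k / \<epsilon>)) ^ 5"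
    by (simp add: powr_numeral)
  then show ?thesis
    using sparsifier_of_affine[OF P \<epsilon> inst] False by simp
qed

subsection \<open>Quadratic lower bound\<close>

text \<open>Constraints may not contain constants or negations, so the variables 0 and 1 stand for the
  constants and each of the grid variables \<open>4 * i + 2\<close>, \<open>4 * j + 4\<close> is followed by its negation;
  \<open>isolating s i j\<close> is the consistent assignment that satisfies only the constraint \<open>(i, j)\<close>.\<close>

fun lit_var :: "nat \<Rightarrow> nat \<Rightarrow> lit \<Rightarrow> nat" where
  "lit_var i j Zero = 0"
| "lit_var i j One = 1"
| "lit_var i j X = 4 * i + 2"
| "lit_var i j NotX = 4 * i + 3"
| "lit_var i j Y = 4 * j + 4"
| "lit_var i j NotY = 4 * j + 5"

definition isolating :: "nat \<Rightarrow> nat \<Rightarrow> nat \<Rightarrow> nat \<Rightarrow> bool" where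
  "isolating s i j n \<longleftrightarrow> n < 4 * s + 2 \<and>
     (n = 1 \<or> n mod 4 = 2 \<and> n = 4 * i + 2 \<or> n mod 4 = 3 \<and> n \<noteq> 4 * i + 3
      \<or> n mod 4 = 0 \<and> n = 4 * j + 4 \<or> n mod 4 = 1 \<and> n \<noteq> 4 * j + 5)"

lemma isolating_lit_var:
  assumes "i' < s" "j' < s"
  shows "isolating s i j (lit_var i' j' l) = lit_val l (i' = i) (j' = j)"
proof -
  have "(4 * n + 2) mod 4 = 2" "(4 * n + 3) mod 4 = 3" "(4 * n + 4) mod 4 = 0"
    "(4 * n + 5) mod 4 = 1" for n :: nat
    by presburger+
  then show ?thesis
    using assms by (cases l) (simp_all add: isolating_def)
qed

definition grid :: "lit \<Rightarrow> lit \<Rightarrow> lit \<Rightarrow> nat \<Rightarrow> (nat \<times> nat \<times> nat) list" where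
  "grid p1 p2 p3 s = map (\<lambda>(i, j). (lit_var i j p1, lit_var i j p2, lit_var i j p3))
     (List.product [0..<s] [0..<s])"

lemma is_instance_grid:
  assumes "4 * s + 2 \<le> k"
  shows "is_instance k (grid p1 p2 p3 s)"
proof -
  have "lit_var i j l < k" if "i < s" "j < s" for i j l
    using that assms by (cases l) auto
  then show ?thesis by (auto simp: is_instance_def grid_def)
qed

lemma card_sparsifier_grid:
  assumes P: "\<And>x y. P (lit_val p1 x y) (lit_val p2 x y) (lit_val p3 x y) = (x \<and> y)"
    and k: "4 * s + 2 \<le> k" and "\<epsilon> < 1" and sp: "is_sparsifier P k (grid p1 p2 p3 s) \<epsilon> T w"
  shows "card T = s\<^sup>2"
proof -
  let ?ps = "List.product [0..<s] [0..<s]"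
  have len: "length (grid p1 p2 p3 s) = s\<^sup>2" "length ?ps = s\<^sup>2"
    by (simp_all add: grid_def length_product power2_eq_square)
  have T: "T \<subseteq> {..<s\<^sup>2}"
    using sp len by (simp add: is_sparsifier_def)
  have "p \<in> T" if p: "p < s\<^sup>2" for p
  proof (rule ccontr)
    assume "p \<notin> T"
    obtain i j where ij: "?ps ! p = (i, j)" by fastforce
    let ?x = "isolating s i j"
    have val: "constr_val P (grid p1 p2 p3 s ! q) ?x = (if q = p then 1 else 0)" if q: "q < s\<^sup>2" for q
    proof -
      obtain i' j' where ij': "?ps ! q = (i', j')" by fastforce
      have "(i', j') \<in> set ?ps"
        using q len ij' by (metis nth_mem)
      then have "i' < s" "j' < s" by auto
      moreover have "grid p1 p2 p3 s ! q = (lit_var i' j' p1, lit_var i' j' p2, lit_var i' j' p3)"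
        using q len(2) ij' by (simp add: grid_def)
      ultimately have "constr_val P (grid p1 p2 p3 s ! q) ?x = (if i' = i \<and> j' = j then 1 else 0)"
        by (simp add: constr_val_def isolating_lit_var P)
      moreover have "i' = i \<and> j' = j \<longleftrightarrow> q = p"
        using nth_eq_iff_index_eq[of ?ps q p] p q len ij ij' by (auto simp: distinct_product)
      ultimately show ?thesis by simp
    qed
    have "\<forall>n. k \<le> n \<longrightarrow> \<not> ?x n"
      using k by (auto simp: isolating_def)
    then have "(1 - \<epsilon>) * (\<Sum>q<s\<^sup>2. constr_val P (grid p1 p2 p3 s ! q) ?x)
        \<le> (\<Sum>q\<in>T. w q * constr_val P (grid p1 p2 p3 s ! q) ?x)"
      using sp len by (simp add: is_sparsifier_def)
    also have "\<dots> = 0"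
      using T \<open>p \<notin> T\<close> by (intro sum.neutral) (auto simp: val subset_eq)
    also have "(\<Sum>q<s\<^sup>2. constr_val P (grid p1 p2 p3 s ! q) ?x) = 1"
      using p by (simp add: val)
    finally show False using \<open>\<epsilon> < 1\<close> by simp
  qed
  then have "T = {..<s\<^sup>2}" using T by blast
  then show ?thesis by simp
qed

lemma exists_quadratic_instance:
  assumes "has_affine_projection_to_AND P"
  shows "\<exists>c0 :: real. 0 < c0 \<and> (\<forall>\<epsilon> :: real. 0 \<le> \<epsilon> \<and> \<epsilon> < 1 \<longrightarrow>
               (\<exists>K :: nat. \<forall>k \<ge> K. \<exists>cs. is_instance k cs \<and>
                  (\<forall>T w. is_sparsifier P k cs \<epsilon> T w \<longrightarrow> c0 * (real k)\<^sup>2 \<le> real (card T))))"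
proof -
  obtain p1 p2 p3 where P: "\<And>x y. P (lit_val p1 x y) (lit_val p2 x y) (lit_val p3 x y) = (x \<and> y)"
    using assms unfolding has_affine_projection_to_AND_def by metis
  have "\<exists>cs. is_instance k cs \<and>
      (\<forall>T w. is_sparsifier P k cs \<epsilon> T w \<longrightarrow> 1 / 64 * (real k)\<^sup>2 \<le> real (card T))"
    if "10 \<le> k" "\<epsilon> < 1" for k :: nat and \<epsilon> :: real
  proof -
    \<comment> \<open>Two constants and four variables per grid index. From
      \<open>k \<ge> 10\<close> follows \<open>s \<ge> 2\<close>, hence k \<le> 4s + 5 \<le> 8s,
      which gives the constant 1/64.\<close>
    define s where "s = (k - 2) div 4"
    have s: "4 * s + 2 \<le> k" "k \<le> 8 * s"
      using that unfolding s_def by presburger+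
    have "(real k)\<^sup>2 \<le> (8 * real s)\<^sup>2"
      using s(2) by (intro power_mono) linarith+
    then have "1 / 64 * (real k)\<^sup>2 \<le> real (s\<^sup>2)"
      by (simp add: power_mult_distrib)
    then show ?thesis
      using is_instance_grid[OF s(1), of p1 p2 p3] card_sparsifier_grid[of P, OF P s(1) that(2)]
      by (intro exI[of _ "grid p1 p2 p3 s"]) auto
  qed
  then show ?thesis
    by (intro exI[of _ "1/64"]) auto
qed

theorem theorem1p6:
  fixes P :: "bool \<Rightarrow> bool \<Rightarrow> bool \<Rightarrow> bool"
  shows "(\<not> has_affine_projection_to_AND P \<longrightarrow>
            (\<exists>C c :: real. \<forall>\<epsilon> :: real. \<forall>k :: nat. \<forall>cs.
               0 < \<epsilon> \<and> \<epsilon> < 1 \<and> is_instance k cs \<longrightarrow>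
               (\<exists>T w. is_sparsifier P k cs \<epsilon> T w \<and>
                  real (card T) \<le> C * (real k / \<epsilon>\<^sup>2) * (log 2 (4 * real k / \<epsilon>)) powr c)))
       \<and> (has_affine_projection_to_AND P \<longrightarrow>
            (\<exists>c0 :: real. 0 < c0 \<and> (\<forall>\<epsilon> :: real. 0 \<le> \<epsilon> \<and> \<epsilon> < 1 \<longrightarrow>
               (\<exists>K :: nat. \<forall>k \<ge> K. \<exists>cs. is_instance k cs \<and>
                  (\<forall>T w. is_sparsifier P k cs \<epsilon> T w \<longrightarrow> c0 * (real k)\<^sup>2 \<le> real (card T))))))"
proof (intro conjI impI)
  assume "\<not> has_affine_projection_to_AND P"
  then obtain a b c d :: 4
    where P: "\<And>x y z. P x y z \<longleftrightarrow> a * of_bool x + b * of_bool y + c * of_bool z + d \<noteq> 0"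
    using affine_if_no_projection by blast
  show "\<exists>C c :: real. \<forall>\<epsilon> :: real. \<forall>k :: nat. \<forall>cs.
      0 < \<epsilon> \<and> \<epsilon> < 1 \<and> is_instance k cs \<longrightarrow>
      (\<exists>T w. is_sparsifier P k cs \<epsilon> T w \<and>
         real (card T) \<le> C * (real k / \<epsilon>\<^sup>2) * (log 2 (4 * real k / \<epsilon>)) powr c)"
    using exists_sparsifier[OF P] by blast
qed (rule exists_quadratic_instance)

end
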